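(* Let $d\ge1$, $\Omega=(0,1)^d$, and let $0<p,\tau\le\infty$, $1\le q\le\infty$, $s>0$ satisfy $s>d/p$ and $q<p+\frac{2sp}{d}$. Let $K=U(B^s_\tau(L_p(\Omega)))$. Then there is a constant $C>0$, depending only on $s,p,q,\tau,d$, such that for all $m\ge 1$ and all $\sigma\ge 0$, $$R_m(K;\sigma)_q\ge C\left(m^{-\frac sd+\left(\frac1p-\frac1q\right)_+}+\min\left\{1,\left[\frac{\sigma^2}{m}\right]^{\frac{s}{2s+d}}\right\}\right).$$
   Context: Notation: $(a)_+=\max\{a,0\}$; $1/\infty=0$; when $p=\infty$ the right side of $q<p+2sp/d$ is $+\infty$. Besov spaces. Let $\Omega=(0,1)^d$. For a positive integer $r$ and $0<p\le\infty$, $\omega_r(f,t)_p:=\sup_{|h|\le t}\|\Delta_h^r(f,\cdot)\|_{L_p(\Omega_{rh})}$, $t>0$, where $\Delta^r_h(f,\cdot):=(-1)^r\sum_{k=0}^r(-1)^k\binom rk f(\cdot+kh)$ for $h\in\mathbb{R}^d$ and $\Omega_h:=\{x\in\Omega:[x,x+h]\subset\Omega\}$. For $s>0$, $0<p\le\infty$, $0<\tau<\infty$, $B^s_\tau(L_p(\Omega))$ is the set of $f\in L_p(\Omega)$ with $$|f|_{B^s_\tau(L_p(\Omega))}:=\left[\int_0^1[t^{-s}\omega_r(f,t)_p]^\tau\frac{dt}{t}\right]^{1/\tau}<\infty,$$ where $r$ is the smallest integer strictly bigger than $s$; for $\tau=\infty$ the integral is replaced by the supremum of $t^{-s}\omega_r(f,t)_p$.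 The (quasi-)norm is $\|f\|_{B^s_\tau(L_p(\Omega))}:=\|f\|_{L_p(\Omega)}+|f|_{B^s_\tau(L_p(\Omega))}$, and $U(B^s_\tau(L_p(\Omega)))$ is the unit ball, i.e. the set of $f$ with $\|f\|_{B^s_\tau(L_p(\Omega))}\le 1$. When $s>d/p$, every such $f$ is identified with its continuous extension to $\overline\Omega=[0,1]^d$, so point values make sense. Minimax risk. For a set $\mathcal X=\{x_1,\dots,x_m\}\subset\overline\Omega$ of $m$ data sites and $f\in K$, one observes $y=(y_1,\dots,y_m)$, $y_i=f(x_i)+\eta_i$, where $\eta_1,\dots,\eta_m$ are i.i.d. Gaussian with mean $0$ and variance $\sigma^2$ (identically $0$ if $\sigma=0$). An algorithm is a map $A:\mathbb{R}^m\to L_q(\Omega)$ (such that $A(y)$ is an $L_q(\Omega)$-valued random variable). Its worst-case risk is $E_A(K;\sigma,\mathcal X)_q:=\sup_{f\in K}\mathbb{E}\|f-A(y)\|_{L_q(\Omega)}$, with expectation over the noise, and $$R_m(K;\sigma)_q:=\inf_{A,\mathcal X}E_A(K;\sigma,\mathcal X)_q,$$ the infimum being over all algorithms $A$ and all $\mathcal X\subset\overline\Omega$ with $|\mathcal X|=m$. *)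

theory Defs
  imports "HOL-Probability.Probability"
begin

(* Integrability exponents in (0,\<infinity>] are elements of ennreal, so that 1/\<infinity> = 0, and all
   (quasi-)norms and risks take values in ennreal.  Functions on the cube are represented by total
   functions, whose values outside the (closed) cube are never used. *)

abbreviation unit_cube :: "(real^'d) set" where
  "unit_cube \<equiv> box 0 1"

abbreviation closed_unit_cube :: "(real^'d) set" where
  "closed_unit_cube \<equiv> cbox 0 1"

(* Only used with a positive exponent a; then 0 is mapped to 0 and \<infinity> to \<infinity>. *)
definition ennreal_powr :: "ennreal \<Rightarrow> real \<Rightarrow> ennreal" where
  "ennreal_powr x a = (if x = \<infinity> then \<infinity> else ennreal (enn2real x powr a))"

definition Lp_norm :: "ennreal \<Rightarrow> 'a measure \<Rightarrow> ('a \<Rightarrow> real) \<Rightarrow> ennreal" where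
  "Lp_norm p M f =
     (if p = \<infinity> then esssup M (\<lambda>x. ennreal \<bar>f x\<bar>)
      else ennreal_powr (\<integral>\<^sup>+x. ennreal (\<bar>f x\<bar> powr enn2real p) \<partial>M) (1 / enn2real p))"

definition Lp_space :: "ennreal \<Rightarrow> 'a measure \<Rightarrow> ('a \<Rightarrow> real) set" where
  "Lp_space p M = {f \<in> borel_measurable M. Lp_norm p M f < \<infinity>}"

(* The Borel sigma-algebra of the norm topology of L_p(M), on representatives.  An open set in the
   sense below contains with f every function in Lp_space that agrees with f almost everywhere, so
   these are exactly the Borel sets of the space of equivalence classes. *)
definition Lp_open :: "ennreal \<Rightarrow> 'a measure \<Rightarrow> ('a \<Rightarrow> real) set \<Rightarrow> bool" where
  "Lp_open p M U \<longleftrightarrow> U \<subseteq> Lp_space p M \<and>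
     (\<forall>f\<in>U. \<exists>e>0. \<forall>g\<in>Lp_space p M. Lp_norm p M (\<lambda>x. g x - f x) < e \<longrightarrow> g \<in> U)"

definition Lp_borel :: "ennreal \<Rightarrow> 'a measure \<Rightarrow> ('a \<Rightarrow> real) measure" where
  "Lp_borel p M = sigma (Lp_space p M) {U. Lp_open p M U}"

definition fwd_diff :: "nat \<Rightarrow> 'a::real_vector \<Rightarrow> ('a \<Rightarrow> real) \<Rightarrow> 'a \<Rightarrow> real" where
  "fwd_diff r h f x = (-1) ^ r * (\<Sum>k=0..r. (-1) ^ k * real (r choose k) * f (x + real k *\<^sub>R h))"

definition inner_cube :: "real^'d \<Rightarrow> (real^'d) set" where
  "inner_cube h = {x \<in> unit_cube. closed_segment x (x + h) \<subseteq> unit_cube}"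

definition smoothness_modulus :: "nat \<Rightarrow> ennreal \<Rightarrow> (real^'d \<Rightarrow> real) \<Rightarrow> real \<Rightarrow> ennreal" where
  "smoothness_modulus r p f t =
     (SUP h\<in>{h. norm h \<le> t}. Lp_norm p (lebesgue_on (inner_cube (real r *\<^sub>R h))) (fwd_diff r h f))"

definition besov_order :: "real \<Rightarrow> nat" where
  "besov_order s = (LEAST r. s < real r)"

definition besov_seminorm ::
    "real \<Rightarrow> ennreal \<Rightarrow> ennreal \<Rightarrow> (real^'d \<Rightarrow> real) \<Rightarrow> ennreal" where
  "besov_seminorm s \<tau> p f =
     (let \<omega> = smoothness_modulus (besov_order s) p f in
      if \<tau> = \<infinity> then (SUP t\<in>{0<..1}. ennreal (t powr (-s)) * \<omega> t)
      else ennreal_powr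
             (\<integral>\<^sup>+t\<in>{0<..<1}. ennreal_powr (ennreal (t powr (-s)) * \<omega> t) (enn2real \<tau>) / ennreal t \<partial>lborel)
             (1 / enn2real \<tau>))"

definition besov_space :: "real \<Rightarrow> ennreal \<Rightarrow> ennreal \<Rightarrow> (real^'d \<Rightarrow> real) set" where
  "besov_space s \<tau> p =
     {f \<in> Lp_space p (lebesgue_on unit_cube). besov_seminorm s \<tau> p f < \<infinity>}"

definition besov_norm :: "real \<Rightarrow> ennreal \<Rightarrow> ennreal \<Rightarrow> (real^'d \<Rightarrow> real) \<Rightarrow> ennreal" where
  "besov_norm s \<tau> p f = Lp_norm p (lebesgue_on unit_cube) f + besov_seminorm s \<tau> p f"

(* For s > d/p every element of the Besov space has exactly one representative that is continuous
   on the closed cube; the unit ball consists of these representatives, so that point values are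
   meaningful. *)
definition besov_ball :: "real \<Rightarrow> ennreal \<Rightarrow> ennreal \<Rightarrow> (real^'d \<Rightarrow> real) set" where
  "besov_ball s \<tau> p =
     {f \<in> besov_space s \<tau> p. continuous_on closed_unit_cube f \<and> besov_norm s \<tau> p f \<le> 1}"

definition gaussian_law :: "real \<Rightarrow> real measure" where
  "gaussian_law \<sigma> =
     (if \<sigma> = 0 then return borel 0 else density lborel (\<lambda>x. ennreal (normal_density 0 \<sigma> x)))"

(* The joint law of m independent noise variables.  Because of the completion, measurability with
   respect to this law is no restriction at all when \<sigma> = 0. *)
definition noise_law :: "nat \<Rightarrow> real \<Rightarrow> (nat \<Rightarrow> real) measure" where
  "noise_law m \<sigma> = completion (Pi\<^sub>M {..<m} (\<lambda>_. gaussian_law \<sigma>))"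

definition noisy_data ::
    "nat \<Rightarrow> (nat \<Rightarrow> real^'d) \<Rightarrow> (real^'d \<Rightarrow> real) \<Rightarrow> (nat \<Rightarrow> real) \<Rightarrow> (nat \<Rightarrow> real)" where
  "noisy_data m x f \<eta> = (\<lambda>i\<in>{..<m}. f (x i) + \<eta> i)"

definition data_sites :: "nat \<Rightarrow> (nat \<Rightarrow> real^'d) set" where
  "data_sites m = {x. inj_on x {..<m} \<and> x ` {..<m} \<subseteq> closed_unit_cube}"

(* The space R^m of observations is the set of functions that are extensional on {..<m}. *)
definition algorithms ::
    "nat \<Rightarrow> (real^'d \<Rightarrow> real) set \<Rightarrow> real \<Rightarrow> ennreal \<Rightarrow> (nat \<Rightarrow> real^'d) \<Rightarrow>
     ((nat \<Rightarrow> real) \<Rightarrow> (real^'d \<Rightarrow> real)) set" where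
  "algorithms m K \<sigma> q x =
     {A. A \<in> ({..<m} \<rightarrow>\<^sub>E UNIV) \<rightarrow> Lp_space q (lebesgue_on unit_cube) \<and>
         (\<forall>f\<in>K. (\<lambda>\<eta>. A (noisy_data m x f \<eta>)) \<in>
            measurable (noise_law m \<sigma>) (Lp_borel q (lebesgue_on unit_cube)))}"

definition worst_case_risk ::
    "nat \<Rightarrow> (real^'d \<Rightarrow> real) set \<Rightarrow> real \<Rightarrow> ennreal \<Rightarrow> (nat \<Rightarrow> real^'d) \<Rightarrow>
     ((nat \<Rightarrow> real) \<Rightarrow> (real^'d \<Rightarrow> real)) \<Rightarrow> ennreal" where
  "worst_case_risk m K \<sigma> q x A =
     (SUP f\<in>K. \<integral>\<^sup>+\<eta>. Lp_norm q (lebesgue_on unit_cube)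
                        (\<lambda>z. f z - A (noisy_data m x f \<eta>) z) \<partial>noise_law m \<sigma>)"

definition minimax_risk :: "nat \<Rightarrow> (real^'d \<Rightarrow> real) set \<Rightarrow> real \<Rightarrow> ennreal \<Rightarrow> ennreal" where
  "minimax_risk m K \<sigma> q =
     (INF x\<in>data_sites m. INF A\<in>algorithms m K \<sigma> q x. worst_case_risk m K \<sigma> q x A)"

end

theory Submission
  imports Defs
begin

text \<open>
  Divide the cube into \<open>N = M\<^sup>d\<close> cells and let \<open>f\<^sub>S\<close> be \<open>a\<close> times the sum over the cells in \<open>S\<close>
  of a smooth bump scaled to the cell.  Since at most \<open>r + 1\<close> bumps contribute to an \<open>r\<close>-th
  difference at a given point, the Besov norm of \<open>f\<^sub>S\<close> is at most a constant times
  \<open>a M\<^sup>s (card S / N) powr (1/p)\<close>.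

  For the noiseless rate take \<open>N\<close> of order \<open>m\<close>, at least \<open>2 m\<close>, and \<open>S\<close> consisting of cells
  without data sites (\<open>N - m\<close> of them if \<open>q \<le> p\<close>, a single one otherwise): then \<open>f\<^sub>S\<close> and \<open>0\<close> have
  the same data.  For the noise rate take \<open>N\<close> of order \<open>(m / \<sigma>\<^sup>2) powr (d / (2 s + d))\<close> and all \<open>S\<close>:
  adding a cell to \<open>S\<close> changes the law of the data, on average over the cells, by a bounded amount,
  so Assouad's argument applies.  Only \<open>L\<^sub>1\<close> losses on unions of cells enter, and these are bounded
  by \<open>L\<^sub>q\<close> norms through Hoelder's inequality.
\<close>

section \<open>Lebesgue norms\<close>

text \<open>The noise rate is a balance: a cell of side \<open>1/M\<close> holds
  \<open>m / M ^ d\<close> sites on average (\<open>d\<close> is the dimension), and a bump of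
  height about \<open>M powr (-s)\<close> moves the data there by a squared distance of about
  \<open>m * M powr (-2*s-d)\<close>, which must not exceed the order of
  \<open>\<sigma>\<^sup>2\<close>. The sites are arbitrary and may crowd into few cells, so no
  single cell can be controlled; the two-point bound is therefore linear in the squared distance,
  and only the total over all cells matters. Without noise the number of active cells is a free
  parameter: fewer cells allow a larger height, by the power \<open>1/p\<close> of their density,
  while the \<open>L_q\<close> size loses the power \<open>1/q\<close>. The sign of
  \<open>1/p - 1/q\<close> decides which extreme is better. Two obstacles shape the details. For
  \<open>p < 1\<close> the triangle inequality fails, so norms are read off from a supremum and the
  measure of a support. And an algorithm is only measurable for the Borel sets of \<open>L_q\<close>
  and the completed noise law, so every loss in use must be a Borel function on \<open>L_q\<close>,
  and null sets must be followed under shifts.\<close>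

lemma ennreal_powr_ennreal: "0 \<le> x \<Longrightarrow> ennreal_powr (ennreal x) a = ennreal (x powr a)"
  by (simp add: ennreal_powr_def)

lemma ennreal_powr_mono:
  assumes "x \<le> y" "0 \<le> a"
  shows "ennreal_powr x a \<le> ennreal_powr y a"
proof (cases "y = \<infinity>")
  case False
  with assms have "x \<noteq> \<infinity>" by (auto simp: top_unique)
  with False assms show ?thesis
    by (auto simp: ennreal_powr_def intro!: ennreal_leI powr_mono2 enn2real_mono)
      (simp add: less_top)
qed (simp add: ennreal_powr_def)

lemma enn2real_inverse_exponent:
  assumes "p \<noteq> \<infinity>"
  shows "enn2real (1 / p) = 1 / enn2real p"
proof -
  obtain x where "0 \<le> x" "p = ennreal x" using assms by (cases p) auto
  then show ?thesis
    by (cases "x = 0") (auto simp: divide_ennreal simp flip: ennreal_1)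
qed

lemma enn2real_pos_exponent: "0 < (p::ennreal) \<Longrightarrow> p \<noteq> \<infinity> \<Longrightarrow> 0 < enn2real p"
  by (simp add: enn2real_positive_iff less_top)

lemma one_le_enn2real: "1 \<le> (q::ennreal) \<Longrightarrow> q \<noteq> \<infinity> \<Longrightarrow> 1 \<le> enn2real q"
  using enn2real_mono[of 1 q] by (simp add: less_top)

text \<open>Height times a power of the measure of the support: no triangle inequality enters, so
  quasi-norms with \<open>p < 1\<close> are covered, and \<open>1 / \<infinity> = 0\<close> makes
  the same formula correct for the essential supremum.\<close>

lemma Lp_norm_le_of_support:
  assumes p: "0 < p" and g: "g \<in> borel_measurable M" and E: "E \<in> sets M"
    and em: "emeasure M E \<le> ennreal e" and e: "0 < e" and G: "0 \<le> G"
    and b: "\<And>x. x \<in> space M \<Longrightarrow> \<bar>g x\<bar> \<le> G * indicator E x"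
  shows "Lp_norm p M g \<le> ennreal (G * e powr enn2real (1 / p))"
proof (cases "p = \<infinity>")
  case True
  have "esssup M (\<lambda>x. ennreal \<bar>g x\<bar>) \<le> ennreal G"
  proof (rule esssup_I)
    show "AE x in M. ennreal \<bar>g x\<bar> \<le> ennreal G"
    proof (rule AE_I2)
      fix x assume "x \<in> space M"
      from b[OF this] G show "ennreal \<bar>g x\<bar> \<le> ennreal G"
        by (cases "x \<in> E") (auto intro!: ennreal_leI)
    qed
  qed (use g in measurable)
  with True e show ?thesis by (simp add: Lp_norm_def)
next
  case False
  let ?P = "enn2real p"
  have P: "0 < ?P" using p False by (rule enn2real_pos_exponent)
  have "(\<integral>\<^sup>+x. ennreal (\<bar>g x\<bar> powr ?P) \<partial>M) \<le> (\<integral>\<^sup>+x. ennreal (G powr ?P) * indicator E x \<partial>M)"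
  proof (rule nn_integral_mono)
    fix x assume x: "x \<in> space M"
    from b[OF x] P show "ennreal (\<bar>g x\<bar> powr ?P) \<le> ennreal (G powr ?P) * indicator E x"
      by (cases "x \<in> E") (auto intro!: ennreal_leI powr_mono2)
  qed
  also have "\<dots> = ennreal (G powr ?P) * emeasure M E"
    using E by (simp add: nn_integral_cmult_indicator)
  also have "\<dots> \<le> ennreal (G powr ?P) * ennreal e"
    using em by (rule mult_left_mono) simp
  also have "\<dots> = ennreal (G powr ?P * e)" using e by (simp add: ennreal_mult)
  finally have "Lp_norm p M g \<le> ennreal_powr (ennreal (G powr ?P * e)) (1 / ?P)"
    using False P unfolding Lp_norm_def by (simp add: ennreal_powr_mono)
  also have "\<dots> = ennreal (G * e powr enn2real (1 / p))"
    using e G P False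
    by (simp add: ennreal_powr_ennreal powr_mult powr_powr enn2real_inverse_exponent)
  finally show ?thesis .
qed

text \<open>Integrating \<open>t \<le> c + c\<^sup>1\<^sup>-\<^sup>q t\<^sup>q\<close> with the optimal \<open>c\<close> gives Hoelder's
  inequality up to the factor 2.\<close>

lemma nn_integral_le_Lp_norm:
  assumes q: "1 \<le> q" and g: "g \<in> borel_measurable M" and W: "W \<in> sets M"
    and wm: "emeasure M W = ennreal w" and w: "0 < w"
  shows "(\<integral>\<^sup>+x\<in>W. ennreal \<bar>g x\<bar> \<partial>M) \<le> ennreal (2 * w powr (1 - enn2real (1 / q))) * Lp_norm q M g"
proof (cases "q = \<infinity>")
  case True
  let ?N = "esssup M (\<lambda>x. ennreal \<bar>g x\<bar>)"
  have "(\<integral>\<^sup>+x\<in>W. ennreal \<bar>g x\<bar> \<partial>M) \<le> (\<integral>\<^sup>+x. ?N * indicator W x \<partial>M)"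
  proof (rule nn_integral_mono_AE)
    show "AE x in M. ennreal \<bar>g x\<bar> * indicator W x \<le> ?N * indicator W x"
      using esssup_AE[of "\<lambda>x. ennreal \<bar>g x\<bar>" M] by eventually_elim (simp add: mult_right_mono)
  qed
  also have "\<dots> = ?N * ennreal w" using W wm by (simp add: nn_integral_cmult_indicator)
  also have "\<dots> \<le> ennreal (2 * w) * ?N"
    using w by (subst mult.commute) (intro mult_right_mono ennreal_leI, auto)
  finally show ?thesis using True w by (simp add: Lp_norm_def)
next
  case False
  let ?Q = "enn2real q"
  have Q: "1 \<le> ?Q" using q False by (rule one_le_enn2real)
  define I where "I = (\<integral>\<^sup>+x. ennreal (\<bar>g x\<bar> powr ?Q) \<partial>M)"
  have N: "Lp_norm q M g = ennreal_powr I (1 / ?Q)" using False by (simp add: Lp_norm_def I_def)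
  show ?thesis
  proof (cases "I = \<infinity>")
    case True
    then show ?thesis using w unfolding N by (simp add: ennreal_powr_def ennreal_mult_top)
  next
    case finI: False
    then obtain i where i: "0 \<le> i" "I = ennreal i" by (cases I) auto
    show ?thesis
    \<comment> \<open>The threshold \<open>c\<close> below is proportional to the \<open>L_q\<close>
      norm and has to be positive, so a vanishing norm is treated apart.\<close>
    proof (cases "i = 0")
      case True
      have "(\<integral>\<^sup>+x. ennreal (\<bar>g x\<bar> powr ?Q) \<partial>M) = 0" using i True I_def by simp
      then have "AE x in M. ennreal (\<bar>g x\<bar> powr ?Q) = 0"
        using g by (subst (asm) nn_integral_0_iff_AE) auto
      then have "AE x in M. ennreal \<bar>g x\<bar> * indicator W x = 0"
        by eventually_elim (simp add: ennreal_eq_0_iff)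
      then have "(\<integral>\<^sup>+x\<in>W. ennreal \<bar>g x\<bar> \<partial>M) = (\<integral>\<^sup>+x. 0 \<partial>M)" by (rule nn_integral_cong_AE)
      then show ?thesis by simp
    next
      case False
      then have i0: "0 < i" using i by simp
      define N where "N = i powr (1 / ?Q)"
      have N0: "0 < N" using i0 by (simp add: N_def)
      \<comment> \<open>This value makes the two integrals equal: each becomes
        \<open>N * w powr (1 - 1 / ?Q)\<close>, whence the factor 2.\<close>
      define c where "c = N * w powr (- (1 / ?Q))"
      have c0: "0 < c" using N0 w by (simp add: c_def)
      have NQ: "N powr ?Q = i" using i0 Q by (simp add: N_def powr_powr)
      have young: "t \<le> c + c powr (1 - ?Q) * t powr ?Q" if "0 \<le> t" for t :: real
      proof (cases "t \<le> c")
        case False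
        then have "t = t powr (1 - ?Q) * t powr ?Q" using c0 by (simp flip: powr_add)
        also have "\<dots> \<le> c powr (1 - ?Q) * t powr ?Q"
          using False c0 Q by (intro mult_right_mono powr_mono2') auto
        finally show ?thesis using c0 by simp
      next
        case True
        moreover have "0 \<le> c powr (1 - ?Q) * t powr ?Q" by simp
        ultimately show ?thesis by linarith
      qed
      have "(\<integral>\<^sup>+x\<in>W. ennreal \<bar>g x\<bar> \<partial>M)
          \<le> (\<integral>\<^sup>+x. ennreal c * indicator W x + ennreal (c powr (1 - ?Q)) * ennreal (\<bar>g x\<bar> powr ?Q) \<partial>M)"
      proof (rule nn_integral_mono)
        fix x
        have "ennreal \<bar>g x\<bar> \<le> ennreal (c + c powr (1 - ?Q) * \<bar>g x\<bar> powr ?Q)"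
          by (intro ennreal_leI young) simp
        then show "ennreal \<bar>g x\<bar> * indicator W x
            \<le> ennreal c * indicator W x + ennreal (c powr (1 - ?Q)) * ennreal (\<bar>g x\<bar> powr ?Q)"
          using c0 by (cases "x \<in> W") (simp_all add: ennreal_mult ennreal_plus)
      qed
      also have "\<dots> = ennreal c * ennreal w + ennreal (c powr (1 - ?Q)) * ennreal i"
        using W g i wm I_def
        by (subst nn_integral_add) (auto simp: nn_integral_cmult_indicator nn_integral_cmult)
      also have "\<dots> = ennreal (c * w + c powr (1 - ?Q) * i)"
        using c0 w i by (simp add: ennreal_mult)
      also have "c * w = N * w powr (1 - 1 / ?Q)"
        using w by (simp add: c_def powr_diff powr_minus field_simps)
      also have "c powr (1 - ?Q) * i = N * w powr (1 - 1 / ?Q)"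
      proof -
        have "c powr (1 - ?Q) * i = N powr (1 - ?Q) * N powr ?Q * w powr (- (1 / ?Q) * (1 - ?Q))"
          using N0 w unfolding c_def NQ by (simp add: powr_mult powr_powr)
        also have "N powr (1 - ?Q) * N powr ?Q = N" using N0 by (simp flip: powr_add)
        also have "- (1 / ?Q) * (1 - ?Q) = 1 - 1 / ?Q" using Q by (simp add: field_simps)
        finally show ?thesis .
      qed
      also have "ennreal (N * w powr (1 - 1 / ?Q) + N * w powr (1 - 1 / ?Q))
          = ennreal (2 * w powr (1 - enn2real (1 / q))) * ennreal N"
        using N0 \<open>q \<noteq> \<infinity>\<close>
        by (simp add: enn2real_inverse_exponent algebra_simps flip: ennreal_mult)
      also have "ennreal N = Lp_norm q M g"
        using i by (simp add: N_def \<open>Lp_norm q M g = _\<close> ennreal_powr_ennreal)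
      finally show ?thesis .
    qed
  qed
qed

section \<open>The Besov seminorm\<close>

lemma besov_order_gt: "s < real (besov_order s)"
  unfolding besov_order_def by (rule LeastI_ex) (rule reals_Archimedean2)

text \<open>The left side increases up to \<open>t = 1 / M\<close> because \<open>s < r\<close>, and
  decreases afterwards because \<open>s > 0\<close>; its value at the turning point is
  \<open>M powr s\<close>.\<close>

lemma truncated_power_le:
  fixes s t M :: real
  assumes s: "0 < s" "s < real r" and M: "1 \<le> M" and t: "0 < t"
  shows "t powr (-s) * min 1 (M * t) ^ r \<le> M powr s"
proof (cases "M * t \<le> 1")
  case True
  have "(M * t) ^ r = (M * t) powr (real r)" using M t by (simp add: powr_realpow)
  also have "\<dots> \<le> (M * t) powr s" using True M t s by (intro powr_mono') auto
  also have "\<dots> = M powr s * t powr s" using M t by (simp add: powr_mult)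
  finally have "t powr (-s) * (M * t) ^ r \<le> t powr (-s) * (M powr s * t powr s)"
    by (rule mult_left_mono) simp
  also have "\<dots> = M powr s" using t by (simp add: powr_minus field_simps)
  finally show ?thesis using True by (simp add: min_def)
next
  case False
  then have "1 / M < t" using M by (simp add: field_simps)
  then have "t powr (-s) \<le> (1 / M) powr (-s)" using M s by (intro powr_mono2') auto
  also have "\<dots> = M powr s" using M by (simp add: powr_divide powr_minus_divide)
  finally show ?thesis using False by (simp add: min_def)
qed

text \<open>The integral is split at \<open>1 / M\<close>. Below, the exponent
  \<open>(r - s) * T - 1\<close> exceeds \<open>-1\<close>, so the power is integrable at 0; above,
  \<open>- (s * T) - 1\<close> is less than \<open>-1\<close>, so the range may be extended to
  infinity. Both pieces scale like \<open>M powr (s * T)\<close>, and the two reciprocals are their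
  constants.\<close>

lemma besov_integral_le:
  fixes s T H M :: real
  assumes s: "0 < s" "s < real r" and T: "0 < T" and H: "0 \<le> H" and M: "1 \<le> M"
    and b: "\<And>t. t \<in> {0<..1} \<Longrightarrow> \<omega> t \<le> ennreal (H * min 1 (M * t) ^ r)"
  shows "(\<integral>\<^sup>+t\<in>{0<..<1}. ennreal_powr (ennreal (t powr (-s)) * \<omega> t) T / ennreal t \<partial>lborel)
    \<le> ennreal (H powr T * M powr (s * T) * (1 / ((real r - s) * T) + 1 / (s * T)))"
proof -
  let ?f1 = "\<lambda>t. t powr ((real r - s) * T - 1)" and ?f2 = "\<lambda>t. t powr (- (s * T) - 1)"
  have rs: "0 < (real r - s) * T" "0 < s * T" using s T by auto
  have "(?f1 has_integral ((1 / M) powr ((real r - s) * T - 1 + 1) / ((real r - s) * T - 1 + 1))) {0..1/M}"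
    using rs M by (intro has_integral_powr_from_0) auto
  from nn_integral_has_integral_lebesgue'[OF _ this]
  have I1: "(\<integral>\<^sup>+t. ennreal (?f1 t) * indicator {0..1/M} t \<partial>lborel)
      = ennreal ((1 / M) powr ((real r - s) * T) / ((real r - s) * T))"
    by simp
  have "(?f2 has_integral (- ((1 / M) powr (- (s * T) - 1 + 1)) / (- (s * T) - 1 + 1))) {1/M..}"
    using rs M by (intro has_integral_powr_to_inf) auto
  from nn_integral_has_integral_lebesgue'[OF _ this]
  have I2: "(\<integral>\<^sup>+t. ennreal (?f2 t) * indicator {1/M..} t \<partial>lborel)
      = ennreal ((1 / M) powr (- (s * T)) / (s * T))"
    by simp
  have pw: "ennreal_powr (ennreal (t powr (-s)) * \<omega> t) T / ennreal t * indicator {0<..<1} t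
     \<le> ennreal (H powr T * M powr (real r * T)) * (ennreal (?f1 t) * indicator {0..1/M} t)
      + ennreal (H powr T) * (ennreal (?f2 t) * indicator {1/M..} t)" for t
  proof (cases "t \<in> {0<..<1}")
    case True
    then have t: "0 < t" "t < 1" by auto
    have "ennreal (t powr (-s)) * \<omega> t \<le> ennreal (t powr (-s)) * ennreal (H * min 1 (M * t) ^ r)"
      using t by (intro mult_left_mono b) auto
    also have "\<dots> = ennreal (t powr (-s) * (H * min 1 (M * t) ^ r))"
      using t H M by (simp add: ennreal_mult)
    finally have "ennreal_powr (ennreal (t powr (-s)) * \<omega> t) T
        \<le> ennreal_powr (ennreal (t powr (-s) * (H * min 1 (M * t) ^ r))) T"
      using T by (intro ennreal_powr_mono) auto
    also have "\<dots> = ennreal ((t powr (-s) * (H * min 1 (M * t) ^ r)) powr T)"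
      using t H M by (intro ennreal_powr_ennreal) auto
    finally have "ennreal_powr (ennreal (t powr (-s)) * \<omega> t) T / ennreal t
        \<le> ennreal ((t powr (-s) * (H * min 1 (M * t) ^ r)) powr T) / ennreal t"
      by (rule divide_right_mono_ennreal)
    also have "\<dots> = ennreal ((t powr (-s) * (H * min 1 (M * t) ^ r)) powr T / t)"
      using t by (simp add: divide_ennreal)
    finally have le: "ennreal_powr (ennreal (t powr (-s)) * \<omega> t) T / ennreal t
        \<le> ennreal ((t powr (-s) * (H * min 1 (M * t) ^ r)) powr T / t)" .
    show ?thesis
    proof (cases "t \<le> 1 / M")
      case small: True
      then have "M * t \<le> 1" using M by (simp add: field_simps)
      then have "(t powr (-s) * (H * min 1 (M * t) ^ r)) powr T / t
          = (t powr (-s) * (H * ((M * t) powr real r))) powr T / t"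
        using M t by (simp add: min_def powr_realpow)
      also have "\<dots> = H powr T * M powr (real r * T) * (t powr (- s * T) * t powr (real r * T) * t powr (-1))"
        using H M t by (simp add: powr_mult powr_divide powr_powr powr_minus_divide)
      also have "t powr (- s * T) * t powr (real r * T) * t powr (-1) = t powr (- s * T + real r * T + - 1)"
        by (simp only: powr_add)
      also have "- s * T + real r * T + - 1 = (real r - s) * T - 1" by (simp add: algebra_simps)
      finally have "ennreal ((t powr (-s) * (H * min 1 (M * t) ^ r)) powr T / t)
        = ennreal (H powr T * M powr (real r * T)) * ennreal (?f1 t)"
        by (simp add: ennreal_mult)
      with le True small show ?thesis by (simp add: add_increasing2)
    next
      case big: False
      then have "1 \<le> M * t" using M by (simp add: field_simps)
      then have "(t powr (-s) * (H * min 1 (M * t) ^ r)) powr T / t = (t powr (-s) * H) powr T / t"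
        by (simp add: min_def)
      also have "\<dots> = H powr T * (t powr (- s * T) * t powr (-1))"
        using H M t by (simp add: powr_mult powr_divide powr_powr powr_minus_divide)
      also have "t powr (- s * T) * t powr (-1) = t powr (- s * T + - 1)"
        by (simp only: powr_add)
      also have "- s * T + - 1 = - (s * T) - 1" by simp
      finally have "ennreal ((t powr (-s) * (H * min 1 (M * t) ^ r)) powr T / t)
        = ennreal (H powr T) * ennreal (?f2 t)"
        by (simp add: ennreal_mult)
      with le True big show ?thesis by (simp add: add_increasing)
    qed
  qed simp
  have "(\<integral>\<^sup>+t\<in>{0<..<1}. ennreal_powr (ennreal (t powr (-s)) * \<omega> t) T / ennreal t \<partial>lborel)
     \<le> (\<integral>\<^sup>+t. ennreal (H powr T * M powr (real r * T)) * (ennreal (?f1 t) * indicator {0..1/M} t)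
      + ennreal (H powr T) * (ennreal (?f2 t) * indicator {1/M..} t) \<partial>lborel)"
    by (rule nn_integral_mono) (rule pw)
  also have "\<dots> = ennreal (H powr T * M powr (real r * T)) * ennreal ((1 / M) powr ((real r - s) * T) / ((real r - s) * T))
      + ennreal (H powr T) * ennreal ((1 / M) powr (- (s * T)) / (s * T))"
    by (subst nn_integral_add) (auto simp: nn_integral_cmult I1 I2)
  also have "\<dots> = ennreal (H powr T * (M powr (real r * T) * (1 / M) powr ((real r - s) * T)) / ((real r - s) * T)
      + H powr T * (1 / M) powr (- (s * T)) / (s * T))"
    using rs by (simp add: mult.assoc flip: ennreal_mult ennreal_plus)
  also have "M powr (real r * T) * (1 / M) powr ((real r - s) * T) = M powr (s * T)"
    using M by (simp add: powr_divide algebra_simps powr_diff field_simps)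
  also have "(1 / M) powr (- (s * T)) = M powr (s * T)"
    using M by (simp add: powr_divide powr_minus_divide)
  finally show ?thesis by (simp add: algebra_simps)
qed

text \<open>A function oscillating at scale \<open>1 / M\<close> with size \<open>H\<close> has a
  modulus of the assumed shape, and its seminorm is of order \<open>H * M powr s\<close>. The
  constant is chosen before \<open>p\<close>, \<open>f\<close>, \<open>H\<close> and
  \<open>M\<close>, which the later uniform constants rely on.\<close>

lemma besov_seminorm_le:
  fixes s :: real and \<tau> :: ennreal
  assumes s: "0 < s" and \<tau>: "0 < \<tau>"
  shows "\<exists>C>0. \<forall>p (f :: real^'d \<Rightarrow> real) H M. 0 \<le> H \<longrightarrow> 1 \<le> M \<longrightarrow>
    (\<forall>t\<in>{0<..1}. smoothness_modulus (besov_order s) p f t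
        \<le> ennreal (H * min 1 (M * t) ^ besov_order s)) \<longrightarrow>
    besov_seminorm s \<tau> p f \<le> ennreal (C * H * M powr s)"
proof (cases "\<tau> = \<infinity>")
  case True
  show ?thesis
  proof (intro exI[of _ 1] conjI allI impI)
    fix p and f :: "real^'d \<Rightarrow> real" and H M :: real
    assume H: "0 \<le> H" and M: "1 \<le> M"
      and b: "\<forall>t\<in>{0<..1}. smoothness_modulus (besov_order s) p f t
        \<le> ennreal (H * min 1 (M * t) ^ besov_order s)"
    have "ennreal (t powr (-s)) * smoothness_modulus (besov_order s) p f t
        \<le> ennreal (1 * H * M powr s)" if t: "t \<in> {0<..1}" for t
    proof -
      have "ennreal (t powr (-s)) * smoothness_modulus (besov_order s) p f t
        \<le> ennreal (t powr (-s)) * ennreal (H * min 1 (M * t) ^ besov_order s)"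
        using b t by (intro mult_left_mono) auto
      also have "\<dots> = ennreal (H * (t powr (-s) * min 1 (M * t) ^ besov_order s))"
        using H M t by (simp add: algebra_simps flip: ennreal_mult)
      also have "\<dots> \<le> ennreal (H * M powr s)"
        using H s M t besov_order_gt by (intro ennreal_leI mult_left_mono truncated_power_le) auto
      finally show ?thesis by simp
    qed
    then show "besov_seminorm s \<tau> p f \<le> ennreal (1 * H * M powr s)"
      using True by (auto simp: besov_seminorm_def Let_def intro: SUP_least)
  qed simp
next
  case False
  let ?T = "enn2real \<tau>" and ?r = "real (besov_order s)"
  have T: "0 < ?T" using \<tau> False by (rule enn2real_pos_exponent)
  define \<kappa> where "\<kappa> = 1 / ((?r - s) * ?T) + 1 / (s * ?T)"
  have k: "0 < \<kappa>" using besov_order_gt[of s] s T by (simp add: \<kappa>_def add_pos_pos)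
  show ?thesis
  proof (intro exI[of _ "\<kappa> powr (1 / ?T)"] conjI allI impI)
    fix p and f :: "real^'d \<Rightarrow> real" and H M :: real
    assume H: "0 \<le> H" and M: "1 \<le> M"
      and b: "\<forall>t\<in>{0<..1}. smoothness_modulus (besov_order s) p f t
        \<le> ennreal (H * min 1 (M * t) ^ besov_order s)"
    have "besov_seminorm s \<tau> p f \<le> ennreal_powr (ennreal (H powr ?T * M powr (s * ?T) * \<kappa>)) (1 / ?T)"
      using False T besov_integral_le[OF s besov_order_gt T H M, of "smoothness_modulus (besov_order s) p f"] b
      unfolding besov_seminorm_def Let_def \<kappa>_def by (auto intro!: ennreal_powr_mono)
    also have "\<dots> = ennreal (\<kappa> powr (1 / ?T) * H * M powr s)"
      using H M k T by (simp add: ennreal_powr_ennreal powr_mult powr_powr)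
    finally show "besov_seminorm s \<tau> p f \<le> ennreal (\<kappa> powr (1 / ?T) * H * M powr s)" .
  qed (use k in simp)
qed

section \<open>Differences and bump functions\<close>

lemma fwd_diff_0 [simp]: "fwd_diff 0 h f x = f x"
  by (simp add: fwd_diff_def)

lemma fwd_diff_translate: "fwd_diff r h (\<lambda>x. f (x + c)) x = fwd_diff r h f (x + c)"
  by (simp add: fwd_diff_def algebra_simps)

lemma fwd_diff_add: "fwd_diff r h (\<lambda>x. f x + g x) x = fwd_diff r h f x + fwd_diff r h g x"
  by (simp add: fwd_diff_def algebra_simps sum.distrib)

lemma fwd_diff_diff: "fwd_diff r h (\<lambda>x. f x - g x) x = fwd_diff r h f x - fwd_diff r h g x"
  by (simp add: fwd_diff_def algebra_simps sum_subtractf)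

lemma fwd_diff_cmult: "fwd_diff r h (\<lambda>x. c * f x) x = c * fwd_diff r h f x"
  by (simp add: fwd_diff_def sum_distrib_left algebra_simps)

lemma fwd_diff_sum: "fwd_diff r h (\<lambda>x. \<Sum>j\<in>S. f j x) x = (\<Sum>j\<in>S. fwd_diff r h (f j) x)"
  unfolding fwd_diff_def by (simp add: sum_distrib_left) (rule sum.swap)

lemma fwd_diff_eq_0:
  assumes "\<And>k. k \<le> r \<Longrightarrow> f (x + real k *\<^sub>R h) = 0"
  shows "fwd_diff r h f x = 0"
  using assms by (simp add: fwd_diff_def)

text \<open>Pascal's rule after an index shift. It turns the binomial sum of the definition into a
  recursion on the order.\<close>

lemma fwd_diff_Suc: "fwd_diff (Suc r) h f x = fwd_diff r h f (x + h) - fwd_diff r h f x"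
proof -
  let ?a = "\<lambda>k. f (x + real k *\<^sub>R h)"
  have "(\<Sum>k=0..r. (-1) ^ k * real (r choose k) * ?a k)
      = (\<Sum>k=0..Suc r. (-1) ^ k * real (r choose k) * ?a k)"
    by simp
  also have "\<dots> = ?a 0 + (\<Sum>k=0..r. (-1) ^ Suc k * real (r choose Suc k) * ?a (Suc k))"
    by (subst sum.atLeast0_atMost_Suc_shift) simp
  finally have 1: "(\<Sum>k=0..r. (-1) ^ k * real (r choose k) * ?a k) = \<dots>" .
  have "(\<Sum>k=0..Suc r. (-1) ^ k * real (Suc r choose k) * ?a k)
      = ?a 0 + (\<Sum>k=0..r. (-1) ^ Suc k * real (Suc r choose Suc k) * ?a (Suc k))"
    by (subst sum.atLeast0_atMost_Suc_shift) simp
  also have "\<dots> = (\<Sum>k=0..r. (-1) ^ k * real (r choose k) * ?a k)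
      - (\<Sum>k=0..r. (-1) ^ k * real (r choose k) * ?a (Suc k))"
    unfolding 1 by (simp add: algebra_simps sum.distrib sum_subtractf sum_negf)
  finally have eq: "(\<Sum>k=0..Suc r. (-1) ^ k * real (Suc r choose k) * ?a k) = \<dots>" .
  have "fwd_diff r h f (x + h) = (-1) ^ r * (\<Sum>k=0..r. (-1) ^ k * real (r choose k) * ?a (Suc k))"
    unfolding fwd_diff_def by (simp add: scaleR_add_left add.assoc)
  moreover have "fwd_diff (Suc r) h f x
      = (-1) ^ Suc r * (\<Sum>k=0..Suc r. (-1) ^ k * real (Suc r choose k) * ?a k)"
    by (simp only: fwd_diff_def)
  ultimately show ?thesis
    unfolding eq by (simp only: fwd_diff_def) (simp add: right_diff_distrib)
qed

lemma fwd_diff_Suc': "fwd_diff (Suc r) h f x = fwd_diff r h (\<lambda>x. f (x + h) - f x) x"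
  by (simp add: fwd_diff_Suc fwd_diff_diff fwd_diff_translate)

lemma abs_fwd_diff_le:
  assumes "\<And>x. \<bar>f x\<bar> \<le> B"
  shows "\<bar>fwd_diff r h f x\<bar> \<le> 2 ^ r * B"
proof (induction r arbitrary: x)
  case (Suc r)
  show ?case using Suc[of "x + h"] Suc[of x] by (simp add: fwd_diff_Suc)
qed (simp add: assms)

lemma continuous_on_fwd_diff:
  fixes f :: "'a::real_normed_vector \<Rightarrow> real"
  assumes "continuous_on UNIV f"
  shows "continuous_on UNIV (fwd_diff r h f)"
proof -
  have "continuous_on UNIV (\<lambda>x. f (x + real k *\<^sub>R h))" for k
    by (rule continuous_on_compose2[OF assms]) (auto intro!: continuous_intros)
  then show ?thesis
    unfolding fwd_diff_def by (intro continuous_intros)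
qed

text \<open>A discrete Leibniz rule: the first difference of \<open>f * g\<close> is the difference
  of \<open>f\<close> times a translate of \<open>g\<close>, plus \<open>f\<close> times the
  difference of \<open>g\<close>. In each summand one constant absorbs a factor
  \<open>\<eta>\<close>, and having two summands doubles the bound at each order.\<close>

lemma abs_fwd_diff_mult_le:
  assumes "0 \<le> \<eta>"
    and "\<And>j x. j \<le> k \<Longrightarrow> \<bar>fwd_diff j h f x\<bar> \<le> A * \<eta> ^ j"
    and "\<And>j x. j \<le> k \<Longrightarrow> \<bar>fwd_diff j h g x\<bar> \<le> B * \<eta> ^ j"
  shows "\<bar>fwd_diff k h (\<lambda>x. f x * g x) x\<bar> \<le> 2 ^ k * (A * B) * \<eta> ^ k"
  using assms
proof (induction k arbitrary: f g A B x)
  case 0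
  have "\<bar>f x\<bar> * \<bar>g x\<bar> \<le> A * B"
  proof (rule mult_mono)
    show A: "\<bar>f x\<bar> \<le> A" "\<bar>g x\<bar> \<le> B" using "0.prems"(2)[of 0 x] "0.prems"(3)[of 0 x] by simp_all
    then show "0 \<le> A" by linarith
  qed simp
  then show ?case by (simp add: abs_mult)
next
  case (Suc k)
  let ?df = "\<lambda>x. f (x + h) - f x" and ?dg = "\<lambda>x. g (x + h) - g x"
  have "(\<lambda>x. f (x + h) * g (x + h) - f x * g x) = (\<lambda>x. ?df x * g (x + h) + f x * ?dg x)"
    by (simp add: algebra_simps)
  then have eq: "fwd_diff (Suc k) h (\<lambda>x. f x * g x) x
      = fwd_diff k h (\<lambda>x. ?df x * g (x + h)) x + fwd_diff k h (\<lambda>x. f x * ?dg x) x"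
    by (simp add: fwd_diff_Suc' fwd_diff_add)
  have "\<bar>fwd_diff k h (\<lambda>x. ?df x * g (x + h)) x\<bar> \<le> 2 ^ k * (A * \<eta> * B) * \<eta> ^ k"
  proof (rule Suc.IH[OF \<open>0 \<le> \<eta>\<close>])
    show "\<bar>fwd_diff j h ?df x\<bar> \<le> A * \<eta> * \<eta> ^ j" if "j \<le> k" for j x
      using Suc.prems(2)[of "Suc j" x] that by (simp add: fwd_diff_Suc' algebra_simps)
    show "\<bar>fwd_diff j h (\<lambda>x. g (x + h)) x\<bar> \<le> B * \<eta> ^ j" if "j \<le> k" for j x
      using Suc.prems(3)[of j "x + h"] that by (simp add: fwd_diff_translate)
  qed
  moreover have "\<bar>fwd_diff k h (\<lambda>x. f x * ?dg x) x\<bar> \<le> 2 ^ k * (A * (B * \<eta>)) * \<eta> ^ k"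
  proof (rule Suc.IH[OF \<open>0 \<le> \<eta>\<close>])
    show "\<bar>fwd_diff j h f x\<bar> \<le> A * \<eta> ^ j" if "j \<le> k" for j x
      using Suc.prems(2)[of j x] that by simp
    show "\<bar>fwd_diff j h ?dg x\<bar> \<le> B * \<eta> * \<eta> ^ j" if "j \<le> k" for j x
      using Suc.prems(3)[of "Suc j" x] that by (simp add: fwd_diff_Suc' algebra_simps)
  qed
  ultimately have "\<bar>fwd_diff (Suc k) h (\<lambda>x. f x * g x) x\<bar>
      \<le> 2 ^ k * (A * \<eta> * B) * \<eta> ^ k + 2 ^ k * (A * (B * \<eta>)) * \<eta> ^ k"
    unfolding eq by linarith
  also have "\<dots> = 2 ^ Suc k * (A * B) * \<eta> ^ Suc k" by (simp add: algebra_simps)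
  finally show ?case .
qed

text \<open>A stand-in for bounded derivatives up to order \<open>r\<close> that is passed on to
  products and to functions of one coordinate without any multivariate calculus. The case
  \<open>k = 0\<close> is boundedness of \<open>f\<close>.\<close>

definition diff_bounded :: "nat \<Rightarrow> ('a::real_normed_vector \<Rightarrow> real) \<Rightarrow> bool" where
  "diff_bounded r f \<longleftrightarrow> (\<exists>C\<ge>0. \<forall>k\<le>r. \<forall>h x. \<bar>fwd_diff k h f x\<bar> \<le> C * norm h ^ k)"

lemma diff_bounded_const: "diff_bounded r (\<lambda>_. c)"
  unfolding diff_bounded_def
proof (intro exI[of _ "\<bar>c\<bar>"] conjI allI impI)
  fix k and h x :: 'a
  show "\<bar>fwd_diff k h (\<lambda>_. c) x\<bar> \<le> \<bar>c\<bar> * norm h ^ k"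
  proof (cases k)
    case (Suc j)
    have "fwd_diff j h (\<lambda>_. c) (x + h) = fwd_diff j h (\<lambda>_. c) x" by (simp only: fwd_diff_def)
    then show ?thesis unfolding Suc fwd_diff_Suc by simp
  qed simp
qed simp

lemma diff_bounded_mult:
  fixes f g :: "'a::real_normed_vector \<Rightarrow> real"
  assumes "diff_bounded r f" "diff_bounded r g"
  shows "diff_bounded r (\<lambda>x. f x * g x)"
proof -
  obtain A where A: "0 \<le> A" "\<And>k h x. k \<le> r \<Longrightarrow> \<bar>fwd_diff k h f x\<bar> \<le> A * norm h ^ k"
    using assms(1) by (auto simp: diff_bounded_def)
  obtain B where B: "0 \<le> B" "\<And>k h x. k \<le> r \<Longrightarrow> \<bar>fwd_diff k h g x\<bar> \<le> B * norm h ^ k"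
    using assms(2) by (auto simp: diff_bounded_def)
  show ?thesis
    unfolding diff_bounded_def
  proof (intro exI[of _ "2 ^ r * (A * B)"] conjI allI impI)
    fix k and h x :: 'a assume k: "k \<le> r"
    have "\<bar>fwd_diff k h (\<lambda>x. f x * g x) x\<bar> \<le> 2 ^ k * (A * B) * norm h ^ k"
      using A B k by (intro abs_fwd_diff_mult_le) auto
    also have "\<dots> \<le> 2 ^ r * (A * B) * norm h ^ k"
      using A B k by (intro mult_right_mono power_increasing) auto
    finally show "\<bar>fwd_diff k h (\<lambda>x. f x * g x) x\<bar> \<le> 2 ^ r * (A * B) * norm h ^ k" .
  qed (use A B in simp)
qed

lemma diff_bounded_prod:
  assumes "finite I" "\<And>i. i \<in> I \<Longrightarrow> diff_bounded r (f i)"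
  shows "diff_bounded r (\<lambda>x. \<Prod>i\<in>I. f i x)"
  using assms
  by (induction I) (auto intro: diff_bounded_const diff_bounded_mult)

lemma diff_bounded_component:
  fixes b :: "real \<Rightarrow> real"
  assumes "diff_bounded r b"
  shows "diff_bounded r (\<lambda>x :: real^'d. b (x $ i))"
proof -
  obtain C where C: "0 \<le> C" "\<And>k h x. k \<le> r \<Longrightarrow> \<bar>fwd_diff k h b x\<bar> \<le> C * norm h ^ k"
    using assms by (auto simp: diff_bounded_def)
  show ?thesis
    unfolding diff_bounded_def
  proof (intro exI[of _ C] conjI allI impI)
    fix k and h x :: "real^'d" assume k: "k \<le> r"
    have "\<bar>fwd_diff k h (\<lambda>x. b (x $ i)) x\<bar> = \<bar>fwd_diff k (h $ i) b (x $ i)\<bar>"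
      by (simp add: fwd_diff_def)
    also have "\<dots> \<le> C * norm (h $ i) ^ k" using C k by blast
    also have "\<dots> \<le> C * norm h ^ k"
      using C by (intro mult_left_mono power_mono Finite_Cartesian_Product.norm_nth_le) auto
    finally show "\<bar>fwd_diff k h (\<lambda>x. b (x $ i)) x\<bar> \<le> C * norm h ^ k" .
  qed (use C in simp)
qed

text \<open>The mean value theorem trades one difference for one derivative and a factor
  \<open>\<bar>h\<bar>\<close>. The induction is over all \<open>i + j \<le> r\<close>, since the
  difference of order \<open>j + 1\<close> of \<open>g i\<close> leads to that of order
  \<open>j\<close> of \<open>g (i + 1)\<close>.\<close>

lemma diff_bounded_derivatives:
  fixes g :: "nat \<Rightarrow> real \<Rightarrow> real"
  assumes der: "\<And>k t. k < r \<Longrightarrow> (g k has_real_derivative g (Suc k) t) (at t)"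
    and bd: "\<And>k t. k \<le> r \<Longrightarrow> \<bar>g k t\<bar> \<le> C"
  shows "diff_bounded r (g 0)"
proof -
  have "\<bar>fwd_diff j h (g i) x\<bar> \<le> C * \<bar>h\<bar> ^ j" if "i + j \<le> r" for i j h x
    using that
  proof (induction j arbitrary: i x)
    case 0
    then show ?case by (simp add: bd)
  next
    case (Suc j)
    have d: "(fwd_diff j h (g i) has_real_derivative fwd_diff j h (g (Suc i)) t) (at t)" for t
    proof -
      have "((\<lambda>x. g i (x + real k *\<^sub>R h)) has_real_derivative g (Suc i) (t + real k *\<^sub>R h)) (at t)" for k
        using Suc.prems der[of i "t + real k * h"] by (simp add: DERIV_shift)
      note this[derivative_intros]
      show ?thesis
        unfolding fwd_diff_def by (auto intro!: derivative_eq_intros sum.cong simp: mult_ac simp del: real_scaleR_def)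
    qed
    have "norm (fwd_diff j h (g i) (x + h) - fwd_diff j h (g i) x) \<le> (C * \<bar>h\<bar> ^ j) * norm (x + h - x)"
    proof (rule field_differentiable_bound[of UNIV])
      show "(fwd_diff j h (g i) has_field_derivative fwd_diff j h (g (Suc i)) z) (at z within UNIV)" for z
        using d by simp
      show "norm (fwd_diff j h (g (Suc i)) z) \<le> C * \<bar>h\<bar> ^ j" for z
        using Suc.IH[of "Suc i" z] Suc.prems by simp
    qed auto
    then show ?case by (simp add: fwd_diff_Suc mult_ac)
  qed
  moreover have "0 \<le> C" using bd[of 0 0] by linarith
  ultimately show ?thesis unfolding diff_bounded_def by (intro exI[of _ C]) auto
qed

section \<open>One-dimensional bumps from polynomials extended by zero\<close>

definition zero_ext :: "real poly \<Rightarrow> real \<Rightarrow> real" where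
  "zero_ext P t = (if t \<in> {0..1} then poly P t else 0)"

text \<open>Only the endpoints need an argument: there the difference quotient of the extension is
  dominated by that of the polynomial, which tends to 0.\<close>

lemma zero_ext_has_derivative:
  assumes z: "poly P 0 = 0" "poly P 1 = 0" "poly (pderiv P) 0 = 0" "poly (pderiv P) 1 = 0"
  shows "(zero_ext P has_real_derivative zero_ext (pderiv P) t) (at t)"
proof -
  consider "t \<in> {0<..<1}" | "t \<in> - {0..1}" | "t = 0 \<or> t = 1" by fastforce
  then show ?thesis
  proof cases
    case 1
    have "(zero_ext P has_real_derivative poly (pderiv P) t) (at t)"
      by (rule has_field_derivative_transform_within_open[OF poly_DERIV open_greaterThanLessThan 1])
        (auto simp: zero_ext_def)
    with 1 show ?thesis by (simp add: zero_ext_def)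
  next
    case 2
    have "(zero_ext P has_real_derivative 0) (at t)"
      by (rule has_field_derivative_transform_within_open[OF DERIV_const[of 0] open_Compl[OF closed_atLeastAtMost] 2])
        (auto simp: zero_ext_def)
    moreover have "zero_ext (pderiv P) t = 0" using 2 by (auto simp: zero_ext_def)
    ultimately show ?thesis by simp
  next
    case 3
    then have t: "poly P t = 0" "poly (pderiv P) t = 0" "zero_ext P t = 0" "zero_ext (pderiv P) t = 0"
      using z by (auto simp: zero_ext_def)
    have "((\<lambda>y. (poly P y - poly P t) / (y - t)) \<longlongrightarrow> 0) (at t)"
      using poly_DERIV[of P t] t(2) unfolding has_field_derivative_iff by simp
    then have "((\<lambda>y. norm ((poly P y - poly P t) / (y - t))) \<longlongrightarrow> 0) (at t)"
      by (rule tendsto_norm_zero)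
    then have "((\<lambda>y. (zero_ext P y - zero_ext P t) / (y - t)) \<longlongrightarrow> 0) (at t)"
      by (rule Lim_null_comparison[rotated])
        (auto intro!: always_eventually simp: zero_ext_def t)
    with t(4) show ?thesis unfolding has_field_derivative_iff by simp
  qed
qed

lemma power_dvd_pderiv:
  fixes q :: "real poly"
  assumes "q ^ Suc n dvd P"
  shows "q ^ n dvd pderiv P"
proof -
  obtain R where "P = q ^ Suc n * R" using assms by (elim dvdE)
  then have "pderiv P = q ^ Suc n * pderiv R + pderiv (q ^ Suc n) * R"
    by (simp only: pderiv_mult) (simp add: algebra_simps)
  then show ?thesis
    by (simp only: pderiv_power_Suc) (auto intro!: dvd_add dvd_mult2[of _ "q * q ^ n"] dvd_mult2[of _ "q ^ n * _"] dvd_mult2[of _ "q ^ n"] dvd_smult)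
qed

lemma bounded_zero_ext: "\<exists>B. \<forall>t. \<bar>zero_ext P t\<bar> \<le> B"
proof -
  have "bounded (poly P ` {0..1})"
    by (intro compact_imp_bounded compact_continuous_image continuous_intros) auto
  then obtain B where B: "\<And>t. t \<in> {0..1} \<Longrightarrow> \<bar>poly P t\<bar> \<le> B"
    by (force simp: bounded_iff)
  then have "\<bar>zero_ext P t\<bar> \<le> \<bar>B\<bar>" for t
    using B[of t] abs_ge_self[of B] by (auto simp: zero_ext_def intro: order_trans)
  then show ?thesis by blast
qed

text \<open>Each differentiation costs at most one factor \<open>q\<close>, so the exponent
  \<open>r + 1\<close> leaves at least one factor in every derivative of order up to
  \<open>r\<close>. All of these therefore vanish at 0 and 1, and the extension can be
  differentiated \<open>r\<close> times.\<close>

lemma diff_bounded_zero_ext_power: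
  assumes q: "poly q 0 = 0" "poly q 1 = 0"
  shows "diff_bounded r (zero_ext (q ^ Suc r))"
proof -
  define P where "P k = (pderiv ^^ k) (q ^ Suc r)" for k
  have P_Suc: "P (Suc k) = pderiv (P k)" for k by (simp add: P_def)
  have dvd: "q ^ (Suc r - k) dvd P k" if "k \<le> Suc r" for k
    using that
  proof (induction k)
    case (Suc k)
    moreover from Suc.prems have "Suc (Suc r - Suc k) = Suc r - k" by simp
    ultimately have "q ^ Suc (Suc r - Suc k) dvd P k" by (simp del: power_Suc diff_Suc_Suc)
    from power_dvd_pderiv[OF this] show ?case by (simp add: P_Suc)
  qed (simp add: P_def)
  have z: "poly (P k) 0 = 0" "poly (P k) 1 = 0" if "k \<le> r" for k
  proof -
    have "q dvd q ^ (Suc r - k)" using that by (intro dvd_power) auto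
    also have "\<dots> dvd P k" using that by (intro dvd) simp
    finally obtain R where "P k = q * R" by (elim dvdE)
    then show "poly (P k) 0 = 0" "poly (P k) 1 = 0" using q by simp_all
  qed
  have "\<forall>k. \<exists>B. \<forall>t. \<bar>zero_ext (P k) t\<bar> \<le> B" by (intro allI bounded_zero_ext)
  then obtain B where B: "\<And>k t. \<bar>zero_ext (P k) t\<bar> \<le> B k" by metis
  have "diff_bounded r ((\<lambda>k. zero_ext (P k)) 0)"
  proof (rule diff_bounded_derivatives)
    fix k t assume k: "k < r"
    then show "(zero_ext (P k) has_real_derivative zero_ext (P (Suc k)) t) (at t)"
      unfolding P_Suc using z[of k] z[of "Suc k"] by (intro zero_ext_has_derivative) (simp_all add: P_Suc)
  next
    fix k t assume k: "k \<le> r"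
    have "B k \<le> (\<Sum>k\<le>r. B k)"
      using k order_trans[OF abs_ge_zero B] by (intro member_le_sum) auto
    then show "\<bar>zero_ext (P k) t\<bar> \<le> (\<Sum>k\<le>r. B k)" using B[of k t] by linarith
  qed
  then show ?thesis by (simp add: P_def)
qed

text \<open>The factor \<open>16/3\<close> makes the bump at least 1 on \<open>[1/4, 3/4]\<close>.\<close>

definition bump1 :: "nat \<Rightarrow> real \<Rightarrow> real" where
  "bump1 r = zero_ext ([:0, 16/3, -16/3:] ^ Suc r)"

lemma bump1_eq: "bump1 r t = (if t \<in> {0..1} then (16/3 * t * (1 - t)) ^ Suc r else 0)"
proof -
  have "poly [:0, 16/3, -16/3:] t = 16/3 * t * (1 - t)" by (simp add: algebra_simps)
  then show ?thesis by (simp only: bump1_def zero_ext_def poly_power)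
qed

lemma diff_bounded_bump1: "diff_bounded r (bump1 r)"
  unfolding bump1_def by (rule diff_bounded_zero_ext_power) simp_all

lemma continuous_on_bump1: "continuous_on UNIV (bump1 r)"
proof -
  \<comment> \<open>Truncating the base at 0 replaces the case distinction, because the exponent
    \<open>Suc r\<close> is positive.\<close>
  have "bump1 r = (\<lambda>t. max 0 (16/3 * t * (1 - t)) ^ Suc r)"
  proof
    fix t :: real
    have "t * (1 - t) \<ge> 0 \<longleftrightarrow> t \<in> {0..1}" by (auto simp: zero_le_mult_iff)
    then show "bump1 r t = max 0 (16/3 * t * (1 - t)) ^ Suc r"
      unfolding bump1_eq by (auto simp: max_def mult.assoc)
  qed
  then show ?thesis by (auto intro!: continuous_intros)
qed

lemma bump1_nonneg: "0 \<le> bump1 r t"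
  by (auto simp: bump1_eq)

lemma bump1_support: "bump1 r t \<noteq> 0 \<Longrightarrow> 0 < t \<and> t < 1"
  by (cases "t = 0 \<or> t = 1") (auto simp: bump1_eq split: if_splits)

lemma bump1_ge_1: "1/4 \<le> t \<Longrightarrow> t \<le> 3/4 \<Longrightarrow> 1 \<le> bump1 r t"
proof -
  assume t: "1/4 \<le> t" "t \<le> 3/4"
  have "16/3 * t * (1 - t) = 1 + 16/3 * ((t - 1/4) * (3/4 - t))" by (simp add: field_simps)
  moreover have "0 \<le> (t - 1/4) * (3/4 - t)" using t by simp
  ultimately have "1 \<le> 16/3 * t * (1 - t)" by linarith
  from one_le_power[OF this, of "Suc r"] t show ?thesis by (simp add: bump1_eq)
qed

definition bump :: "nat \<Rightarrow> real^'d \<Rightarrow> real" where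
  "bump r x = (\<Prod>i\<in>UNIV. bump1 r (x $ i))"

lemma bump_nonneg: "0 \<le> bump r x"
  unfolding bump_def by (intro prod_nonneg) (simp add: bump1_nonneg)

lemma bump_support: "bump r x \<noteq> 0 \<Longrightarrow> 0 < x $ i \<and> x $ i < 1"
  unfolding bump_def by (rule bump1_support) auto

lemma bump_ge_1: "(\<And>i. 1/4 \<le> x $ i \<and> x $ i \<le> 3/4) \<Longrightarrow> 1 \<le> bump r x"
  unfolding bump_def by (intro prod_ge_1) (auto intro: bump1_ge_1)

lemma continuous_on_bump: "continuous_on UNIV (bump r)"
  unfolding bump_def
  by (intro continuous_on_prod continuous_on_compose2[OF continuous_on_bump1] continuous_intros) auto

lemma diff_bounded_bump: "diff_bounded r (bump r :: real^'d \<Rightarrow> real)"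
  unfolding bump_def
  by (intro diff_bounded_prod diff_bounded_component diff_bounded_bump1) simp

section \<open>Sums of bumps in the Besov ball\<close>

definition cells :: "nat \<Rightarrow> ('d \<Rightarrow> nat) set" where
  "cells M = (UNIV \<rightarrow>\<^sub>E {..<M})"

definition cell :: "nat \<Rightarrow> ('d \<Rightarrow> nat) \<Rightarrow> (real^'d) set" where
  "cell M j = cbox (\<chi> i. real (j i) / real M) (\<chi> i. (real (j i) + 1) / real M)"

text \<open>The concentric half-size cube, on which the bump of the cell is at least 1. Distinct
  cores are disjoint, whereas neighbouring closed cells share faces.\<close>

definition core :: "nat \<Rightarrow> ('d \<Rightarrow> nat) \<Rightarrow> (real^'d) set" where
  "core M j = cbox (\<chi> i. (real (j i) + 1/4) / real M) (\<chi> i. (real (j i) + 3/4) / real M)"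

definition cell_bump :: "nat \<Rightarrow> nat \<Rightarrow> ('d \<Rightarrow> nat) \<Rightarrow> real^'d \<Rightarrow> real" where
  "cell_bump r M j x = bump r (real M *\<^sub>R x - (\<chi> i. real (j i)))"

definition bump_sum :: "nat \<Rightarrow> nat \<Rightarrow> real \<Rightarrow> ('d \<Rightarrow> nat) set \<Rightarrow> real^'d \<Rightarrow> real" where
  "bump_sum r M a S x = a * (\<Sum>j\<in>S. cell_bump r M j x)"

lemma finite_cells [simp]: "finite (cells M :: ('d::finite \<Rightarrow> nat) set)"
  unfolding cells_def by (intro finite_PiE) auto

lemma card_cells: "card (cells M :: ('d::finite \<Rightarrow> nat) set) = M ^ CARD('d)"
  unfolding cells_def by (simp add: card_PiE)

lemma cell_bump_nonneg: "0 \<le> cell_bump r M j x"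
  by (simp add: cell_bump_def bump_nonneg)

lemma cell_bump_support:
  assumes "cell_bump r M j x \<noteq> 0"
  shows "real (j i) < real M * x $ i \<and> real M * x $ i < real (j i) + 1"
  using bump_support[OF assms[unfolded cell_bump_def], of i] by simp

lemma cell_bump_support_cell:
  assumes "1 \<le> M" "cell_bump r M j x \<noteq> 0"
  shows "x \<in> cell M j"
proof -
  have "real (j i) / real M \<le> x $ i \<and> x $ i \<le> (real (j i) + 1) / real M" for i
    using cell_bump_support[OF assms(2), of i] assms(1) by (simp add: field_simps)
  then show ?thesis by (simp add: cell_def mem_box_cart)
qed

text \<open>A bump vanishes on the faces of its cell, so \<open>real M * x $ i\<close> lies strictly
  between \<open>j i\<close> and \<open>j i + 1\<close>, which determines
  \<open>j i\<close>.\<close>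

lemma cell_bump_unique:
  assumes "cell_bump r M j x \<noteq> 0" "cell_bump r M j' x \<noteq> 0"
  shows "j = j'"
proof
  fix i
  show "j i = j' i"
    using cell_bump_support[OF assms(1), of i] cell_bump_support[OF assms(2), of i] by linarith
qed

lemma card_cell_bump_le_1: "card {j \<in> S. cell_bump r M j x \<noteq> 0} \<le> 1"
proof (cases "{j \<in> S. cell_bump r M j x \<noteq> 0} = {}")
  case False
  then obtain j where "j \<in> S" "cell_bump r M j x \<noteq> 0" by auto
  then have "{j \<in> S. cell_bump r M j x \<noteq> 0} = {j}" using cell_bump_unique by blast
  then show ?thesis by simp
next
  case True
  then show ?thesis by (simp only: card.empty)
qed

lemma mem_core:
  assumes "1 \<le> M"
  shows "x \<in> core M j \<longleftrightarrow> (\<forall>i. real (j i) + 1/4 \<le> real M * x $ i \<and> real M * x $ i \<le> real (j i) + 3/4)"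
  using assms by (auto simp: core_def mem_box_cart field_simps)

lemma cell_bump_ge_1:
  assumes "1 \<le> M" "x \<in> core M j"
  shows "1 \<le> cell_bump r M j x"
  unfolding cell_bump_def
proof (rule bump_ge_1)
  fix i
  have "real (j i) + 1/4 \<le> real M * x $ i" "real M * x $ i \<le> real (j i) + 3/4"
    using assms(2) by (auto simp: mem_core[OF assms(1)])
  then show "1/4 \<le> (real M *\<^sub>R x - (\<chi> i. real (j i))) $ i
      \<and> (real M *\<^sub>R x - (\<chi> i. real (j i))) $ i \<le> 3/4"
    by simp
qed

lemma core_disjoint:
  assumes "1 \<le> M" "j \<noteq> j'"
  shows "core M j \<inter> core M j' = {}"
proof (rule ccontr)
  assume "core M j \<inter> core M j' \<noteq> {}"
  then obtain x where "x \<in> core M j" "x \<in> core M j'" by auto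
  then have "cell_bump 0 M j x \<noteq> 0" "cell_bump 0 M j' x \<noteq> 0"
    using cell_bump_ge_1[OF assms(1), of x _ 0] by force+
  with cell_bump_unique assms(2) show False by blast
qed

lemma disjoint_family_core: "1 \<le> M \<Longrightarrow> disjoint_family_on (core M) J"
  unfolding disjoint_family_on_def using core_disjoint by blast

lemma core_subset:
  assumes "1 \<le> M" "j \<in> cells M"
  shows "core M j \<subseteq> unit_cube"
proof
  fix x assume x: "x \<in> core M j"
  have "0 < x $ i \<and> x $ i < 1" for i
  proof -
    have "j i < M" using assms(2) by (auto simp: cells_def)
    then have j: "real (j i) + 1 \<le> real M" by linarith
    have xi: "real (j i) + 1/4 \<le> real M * x $ i" "real M * x $ i \<le> real (j i) + 3/4"
      using x by (auto simp: mem_core[OF assms(1)])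
    have "0 < real M * x $ i" "real M * x $ i < real M" using j xi by linarith+
    then show ?thesis
      using mult_left_less_imp_less[of "real M" "x $ i" 1]
      by (simp only: zero_less_mult_iff mult.right_neutral of_nat_0_le_iff) auto
  qed
  then show "x \<in> unit_cube" by (simp add: mem_box_cart)
qed

lemma emeasure_lebesgue_cbox: "emeasure lebesgue (cbox a b) = ennreal (measure lborel (cbox a b))"
  using emeasure_lborel_cbox_finite[of a b] by (simp add: emeasure_eq_ennreal_measure less_top)

lemma emeasure_core:
  fixes j :: "'d::finite \<Rightarrow> nat"
  assumes "1 \<le> M"
  shows "emeasure lebesgue (core M j :: (real^'d) set) = ennreal ((1 / (2 * real M)) ^ CARD('d))"
proof -
  have "core M j \<noteq> {}"
    using assms by (auto simp: core_def interval_ne_empty_cart divide_right_mono)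
  then have "measure lborel (core M j :: (real^'d) set) = (\<Prod>i\<in>(UNIV::'d set). 1 / (2 * real M))"
    unfolding core_def
    by (subst content_cbox_cart) (auto simp: core_def algebra_simps diff_divide_distrib[symmetric] intro!: prod.cong)
  then show ?thesis
    by (simp add: core_def emeasure_lebesgue_cbox)
qed

lemma emeasure_cell:
  fixes j :: "'d::finite \<Rightarrow> nat"
  assumes "1 \<le> M"
  shows "emeasure lebesgue {x :: real^'d. x + c \<in> cell M j} = ennreal ((1 / real M) ^ CARD('d))"
    and "{x :: real^'d. x + c \<in> cell M j} \<in> sets lebesgue"
proof -
  have eq: "{x. x + c \<in> cell M j}
      = cbox (\<chi> i. real (j i) / real M - c $ i) (\<chi> i. (real (j i) + 1) / real M - c $ i)"
    by (auto simp: cell_def mem_box_cart algebra_simps)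
  have "cbox (\<chi> i. real (j i) / real M - c $ i) (\<chi> i. (real (j i) + 1) / real M - c $ i) \<noteq> ({} :: (real^'d) set)"
    using assms by (auto simp: interval_ne_empty_cart divide_right_mono)
  then have "measure lborel {x. x + c \<in> cell M j} = (\<Prod>i\<in>(UNIV::'d set). 1 / real M)"
    unfolding eq by (subst content_cbox_cart) (auto simp: add_divide_distrib)
  then show "emeasure lebesgue {x. x + c \<in> cell M j} = ennreal ((1 / real M) ^ CARD('d))"
    by (simp add: eq emeasure_lebesgue_cbox)
  show "{x. x + c \<in> cell M j} \<in> sets lebesgue" by (simp add: eq)
qed

lemma fwd_diff_cell_bump:
  "fwd_diff k h (cell_bump r M j) x
    = fwd_diff k (real M *\<^sub>R h) (bump r) (real M *\<^sub>R x - (\<chi> i. real (j i)))"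
  unfolding fwd_diff_def cell_bump_def by (simp add: algebra_simps)

lemma continuous_on_bump_sum: "continuous_on UNIV (bump_sum r M a S)"
  unfolding bump_sum_def cell_bump_def
  by (intro continuous_intros continuous_on_compose2[OF continuous_on_bump]) auto

text \<open>By convexity a segment lies in the cube as soon as its endpoints do. Hence this set is
  open, and so measurable.\<close>

lemma inner_cube_eq: "inner_cube h = unit_cube \<inter> {x. x + h \<in> unit_cube}"
  using convex_contains_segment[of "unit_cube :: (real^'d) set"]
  by (auto simp: inner_cube_def)

lemma sets_inner_cube: "inner_cube (h :: real^'d) \<in> sets lebesgue"
proof -
  have "open {x :: real^'d. x + h \<in> unit_cube}"
    by (rule open_vimage[of unit_cube "\<lambda>x. x + h", unfolded vimage_def])
      (auto intro!: continuous_intros)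
  then show ?thesis
    unfolding inner_cube_eq by (intro sets.Int lborelD borel_open) auto
qed

lemma bump_bound: "\<exists>B>0. \<forall>x :: real^'d. bump r x \<le> B"
proof -
  obtain C where C: "0 \<le> C" "\<forall>k\<le>r. \<forall>h x. \<bar>fwd_diff k h (bump r :: real^'d \<Rightarrow> real) x\<bar> \<le> C * norm h ^ k"
    using diff_bounded_bump[of r] unfolding diff_bounded_def by blast
  have "bump r x \<le> C + 1" for x :: "real^'d"
    using C(2)[rule_format, of 0 0 x] by simp
  with C(1) show ?thesis by (intro exI[of _ "C + 1"]) auto
qed

text \<open>A difference is nonzero at \<open>x\<close> only if some \<open>x + l h\<close> with
  \<open>l \<le> k\<close> meets a cell of \<open>S\<close>, so the support lies in
  \<open>k + 1\<close> translates of the cells of \<open>S\<close>; this gives the measure in the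
  bound. The order \<open>k\<close> is left free because \<open>k = 0\<close> yields the norm of the
  function itself, and \<open>n\<close> is separate from \<open>card S\<close> so that one height
  can serve all sets of at most \<open>n\<close> cells, including the empty one.\<close>

lemma Lp_norm_fwd_diff_bump_sum:
  fixes r :: nat
  shows "\<exists>C>0. \<forall>p M n a k h (S :: ('d::finite \<Rightarrow> nat) set) (X :: (real^'d) set).
    0 < p \<longrightarrow> 1 \<le> M \<longrightarrow> 1 \<le> n \<longrightarrow> finite S \<longrightarrow> card S \<le> n \<longrightarrow> 0 \<le> a \<longrightarrow> k \<le> r \<longrightarrow> X \<in> sets lebesgue \<longrightarrow>
    Lp_norm p (lebesgue_on X) (fwd_diff k h (bump_sum r M a S))
      \<le> ennreal (C * a * min 1 (real M * norm h) ^ k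
                  * (real (r + 1) * (real n / real M ^ CARD('d))) powr enn2real (1 / p))"
proof -
  obtain C1 where C1: "0 \<le> C1" "\<And>k h x. k \<le> r \<Longrightarrow> \<bar>fwd_diff k h (bump r :: real^'d \<Rightarrow> real) x\<bar> \<le> C1 * norm h ^ k"
    using diff_bounded_bump[of r] unfolding diff_bounded_def by blast
  \<comment> \<open>One constant for both regimes: smoothness of the bump when
    \<open>real M * norm h \<le> 1\<close>, and the trivial bound by \<open>2 ^ k\<close> times the
    supremum otherwise. Adding 1 keeps it positive.\<close>
  define C2 where "C2 = 2 ^ r * (C1 + 1)"
  have C2: "0 < C2" using C1 by (simp add: C2_def add_nonneg_pos)
  have C12: "C1 \<le> C2"
    using C1(1) mult_mono[of 1 "2 ^ r :: real" C1 "C1 + 1"] by (simp add: C2_def)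
  have one: "\<bar>fwd_diff k h (cell_bump r M j) x\<bar> \<le> C2 * min 1 (real M * norm h) ^ k"
    if k: "k \<le> r" for k M and h x :: "real^'d" and j
  proof (cases "real M * norm h \<le> 1")
    case True
    have "\<bar>fwd_diff k h (cell_bump r M j) x\<bar> \<le> C1 * norm (real M *\<^sub>R h) ^ k"
      unfolding fwd_diff_cell_bump using C1(2)[OF k] .
    also have "\<dots> \<le> C2 * norm (real M *\<^sub>R h) ^ k" by (intro mult_right_mono C12) simp
    finally show ?thesis using True by (simp add: min_def)
  next
    case False
    have "\<bar>bump r y\<bar> \<le> C1 + 1" for y :: "real^'d" using C1(2)[of 0 0 y] by simp
    then have "\<bar>fwd_diff k h (cell_bump r M j) x\<bar> \<le> 2 ^ k * (C1 + 1)"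
      unfolding fwd_diff_cell_bump by (rule abs_fwd_diff_le)
    also have "\<dots> \<le> C2"
      unfolding C2_def using C1 k by (intro mult_right_mono power_increasing) auto
    finally show ?thesis using False by (simp add: min_def)
  qed
  show ?thesis
  proof (intro exI[of _ "real (r + 1) * C2"] conjI allI impI)
    fix p :: ennreal and a :: real and M n k :: nat and h :: "real^'d" and S :: "('d \<Rightarrow> nat) set" and X :: "(real^'d) set"
    assume p: "0 < p" and M: "1 \<le> M" and n: "1 \<le> n" and S: "finite S" "card S \<le> n"
      and a: "0 \<le> a" and k: "k \<le> r" and X: "X \<in> sets lebesgue"
    let ?mn = "min 1 (real M * norm h) ^ k"
    let ?g = "fwd_diff k h (bump_sum r M a S)"
    define E where "E = (\<Union>l\<in>{..k}. \<Union>j\<in>S. {x :: real^'d. x + real l *\<^sub>R h \<in> cell M j})"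
    have E: "E \<in> sets lebesgue" unfolding E_def using S emeasure_cell(2)[OF M] by (intro sets.finite_UN) auto
    have "emeasure lebesgue E \<le> (\<Sum>l\<in>{..k}. emeasure lebesgue (\<Union>j\<in>S. {x :: real^'d. x + real l *\<^sub>R h \<in> cell M j}))"
      unfolding E_def using S emeasure_cell(2)[OF M]
      by (intro emeasure_subadditive_finite) (auto intro!: sets.finite_UN)
    also have "\<dots> \<le> (\<Sum>l\<in>{..k}. \<Sum>j\<in>S. emeasure lebesgue {x :: real^'d. x + real l *\<^sub>R h \<in> cell M j})"
      using S emeasure_cell(2)[OF M] by (intro sum_mono emeasure_subadditive_finite) auto
    also have "\<dots> = (\<Sum>l\<in>{..k}. \<Sum>j\<in>S. ennreal ((1 / real M) ^ CARD('d)))"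
      by (simp only: emeasure_cell(1)[OF M])
    also have "\<dots> = (\<Sum>l\<in>{..k}. ennreal (\<Sum>j\<in>S. (1 / real M) ^ CARD('d)))"
      by (intro sum.cong refl sum_ennreal) simp
    also have "\<dots> = ennreal (\<Sum>l\<in>{..k}. \<Sum>j\<in>S. (1 / real M) ^ CARD('d))"
      by (intro sum_ennreal sum_nonneg) simp
    also have "\<dots> = ennreal (real (k + 1) * (real (card S) * (1 / real M) ^ CARD('d)))"
      by simp
    also have "\<dots> \<le> ennreal (real (r + 1) * (real n / real M ^ CARD('d)))"
    proof (intro ennreal_leI mult_mono)
      show "real (card S) * (1 / real M) ^ CARD('d) \<le> real n / real M ^ CARD('d)"
        using S M by (simp add: power_divide divide_right_mono)
    qed (use k in auto)
    finally have emE: "emeasure lebesgue E \<le> ennreal (real (r + 1) * (real n / real M ^ CARD('d)))" .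
    have "Lp_norm p (lebesgue_on X) ?g
        \<le> ennreal (a * (real (r + 1) * (C2 * ?mn)) * (real (r + 1) * (real n / real M ^ CARD('d))) powr enn2real (1 / p))"
    proof (rule Lp_norm_le_of_support[OF p, where E = "X \<inter> E"])
      show "?g \<in> borel_measurable (lebesgue_on X)"
        using continuous_on_subset[OF continuous_on_fwd_diff[OF continuous_on_bump_sum] subset_UNIV] X
        by (rule continuous_imp_measurable_on_sets_lebesgue)
      show "X \<inter> E \<in> sets (lebesgue_on X)" using X E by (auto simp: sets_restrict_space)
      have "emeasure (lebesgue_on X) (X \<inter> E) = emeasure lebesgue (X \<inter> E)"
        using X by (intro emeasure_restrict_space) auto
      also have "\<dots> \<le> emeasure lebesgue E" using E by (intro emeasure_mono) auto
      finally show "emeasure (lebesgue_on X) (X \<inter> E) \<le> ennreal (real (r + 1) * (real n / real M ^ CARD('d)))"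
        using emE by order
      show "0 < real (r + 1) * (real n / real M ^ CARD('d))" using M n by simp
      show "0 \<le> a * (real (r + 1) * (C2 * ?mn))" using a C2 by simp
      fix x assume x: "x \<in> space (lebesgue_on X)"
      let ?D = "\<lambda>j. fwd_diff k h (cell_bump r M j) x"
      let ?S = "{j \<in> S. ?D j \<noteq> 0}"
      have sub: "?S \<subseteq> (\<Union>l\<in>{..k}. {j \<in> S. cell_bump r M j (x + real l *\<^sub>R h) \<noteq> 0})"
      proof
        fix j assume j: "j \<in> ?S"
        then have "\<not> (\<forall>l\<le>k. cell_bump r M j (x + real l *\<^sub>R h) = 0)"
          using fwd_diff_eq_0[of k "cell_bump r M j" x h] by blast
        then show "j \<in> (\<Union>l\<in>{..k}. {j \<in> S. cell_bump r M j (x + real l *\<^sub>R h) \<noteq> 0})"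
          using j by blast
      qed
      have "card ?S \<le> card (\<Union>l\<in>{..k}. {j \<in> S. cell_bump r M j (x + real l *\<^sub>R h) \<noteq> 0})"
        using S by (intro card_mono sub finite_UN_I) auto
      also have "\<dots> \<le> (\<Sum>l\<in>{..k}. card {j \<in> S. cell_bump r M j (x + real l *\<^sub>R h) \<noteq> 0})"
        by (intro card_UN_le) simp
      also have "\<dots> \<le> (\<Sum>l\<in>{..k}. 1)" by (intro sum_mono card_cell_bump_le_1)
      finally have card: "card ?S \<le> r + 1" using k by simp
      have "?g x = a * (\<Sum>j\<in>S. ?D j)"
        unfolding bump_sum_def by (simp add: fwd_diff_cmult fwd_diff_sum)
      also have "(\<Sum>j\<in>S. ?D j) = (\<Sum>j\<in>?S. ?D j)"
        using S by (intro sum.mono_neutral_right) auto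
      finally have g: "\<bar>?g x\<bar> = a * \<bar>\<Sum>j\<in>?S. ?D j\<bar>" using a by (simp add: abs_mult)
      show "\<bar>?g x\<bar> \<le> a * (real (r + 1) * (C2 * ?mn)) * indicator (X \<inter> E) x"
      proof (cases "?S = {}")
        case True
        then have "?g x = 0" using g by simp
        then show ?thesis using a C2 by simp
      next
        case False
        then obtain j l where jl: "j \<in> S" "l \<le> k" "cell_bump r M j (x + real l *\<^sub>R h) \<noteq> 0"
          using sub by blast
        then have "x \<in> E" using cell_bump_support_cell[OF M] unfolding E_def by blast
        with x have ind: "indicator (X \<inter> E) x = (1::real)" by simp
        have "\<bar>\<Sum>j\<in>?S. ?D j\<bar> \<le> (\<Sum>j\<in>?S. \<bar>?D j\<bar>)" by (rule sum_abs)
        also have "\<dots> \<le> (\<Sum>j\<in>?S. C2 * ?mn)" by (intro sum_mono one k)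
        also have "\<dots> = real (card ?S) * (C2 * ?mn)" by simp
        also have "\<dots> \<le> real (r + 1) * (C2 * ?mn)"
          using card C2 by (intro mult_right_mono) auto
        finally show ?thesis unfolding g ind using a by (simp add: mult_left_mono)
      qed
    qed
    then show "Lp_norm p (lebesgue_on X) ?g
        \<le> ennreal (real (r + 1) * C2 * a * ?mn * (real (r + 1) * (real n / real M ^ CARD('d))) powr enn2real (1 / p))"
      by (simp add: mult_ac)
  qed (use C2 in simp)
qed

text \<open>The admissible height is, up to a constant, the reciprocal of the norm bound for a sum
  of bumps of height 1 in \<open>n\<close> cells.\<close>

lemma bump_sum_in_besov_ball:
  fixes s :: real and p \<tau> :: ennreal
  assumes s: "0 < s" and \<tau>: "0 < \<tau>" and p: "0 < p"
  shows "\<exists>c>0. \<forall>M n a (S :: ('d::finite \<Rightarrow> nat) set).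
    1 \<le> M \<longrightarrow> 1 \<le> n \<longrightarrow> finite S \<longrightarrow> card S \<le> n \<longrightarrow> 0 \<le> a \<longrightarrow>
    a \<le> c * real M powr (-s) * (real n / real M ^ CARD('d)) powr (- enn2real (1 / p)) \<longrightarrow>
    (bump_sum (besov_order s) M a S :: real^'d \<Rightarrow> real) \<in> besov_ball s \<tau> p"
proof -
  let ?r = "besov_order s" and ?P = "enn2real (1 / p)"
  obtain C where C: "C > 0" "\<And>p M n a k h (S :: ('d::finite \<Rightarrow> nat) set) (X :: (real^'d) set).
    0 < p \<Longrightarrow> 1 \<le> M \<Longrightarrow> 1 \<le> n \<Longrightarrow> finite S \<Longrightarrow> card S \<le> n \<Longrightarrow> 0 \<le> a \<Longrightarrow> k \<le> ?r \<Longrightarrow> X \<in> sets lebesgue \<Longrightarrow>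
    Lp_norm p (lebesgue_on X) (fwd_diff k h (bump_sum ?r M a S))
      \<le> ennreal (C * a * min 1 (real M * norm h) ^ k
                  * (real (?r + 1) * (real n / real M ^ CARD('d))) powr enn2real (1 / p))"
    using Lp_norm_fwd_diff_bump_sum[where r = ?r and 'd = 'd] by metis
  obtain D where D: "D > 0" "\<And>p (f :: real^'d \<Rightarrow> real) H M. 0 \<le> H \<Longrightarrow> 1 \<le> M \<Longrightarrow>
    (\<And>t. t\<in>{0<..1} \<Longrightarrow> smoothness_modulus ?r p f t \<le> ennreal (H * min 1 (M * t) ^ ?r)) \<Longrightarrow>
    besov_seminorm s \<tau> p f \<le> ennreal (D * H * M powr s)"
    using besov_seminorm_le[OF s \<tau>, where 'd = 'd] by metis
  \<comment> \<open>As \<open>M powr s \<ge> 1\<close>, the \<open>L_p\<close> part \<open>H\<close>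
    is absorbed by the seminorm: the full norm is at most \<open>(1 + D) * H * M powr s\<close>,
    which equals \<open>A * a * y powr ?P * M powr s\<close>.\<close>
  define A where "A = (1 + D) * C * real (?r + 1) powr ?P"
  have A: "0 < A" using C D by (simp add: A_def)
  show ?thesis
  proof (intro exI[of _ "1 / A"] conjI allI impI)
    fix M n :: nat and a :: real and S :: "('d::finite \<Rightarrow> nat) set"
    assume M: "1 \<le> M" and n: "1 \<le> n" and S: "finite S" "card S \<le> n" and a: "0 \<le> a"
      and ale: "a \<le> 1 / A * real M powr (-s) * (real n / real M ^ CARD('d)) powr (- ?P)"
    let ?f = "bump_sum ?r M a S :: real^'d \<Rightarrow> real"
    define y where "y = real n / real M ^ CARD('d)"
    have y: "0 < y" using M n by (simp add: y_def)
    define H where "H = C * a * (real (?r + 1) * y) powr ?P"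
    have H: "0 \<le> H" using C a by (simp add: H_def)
    \<comment> \<open>The bound on the \<open>L_p\<close> norm is the bound on differences of order
      0.\<close>
    have "fwd_diff 0 0 ?f = ?f" by (rule ext) simp
    then have f_le: "Lp_norm p (lebesgue_on unit_cube) ?f \<le> ennreal H"
      using C(2)[OF p M n S a, of 0 unit_cube 0] unfolding H_def y_def by simp
    have sm: "smoothness_modulus ?r p ?f t \<le> ennreal (H * min 1 (real M * t) ^ ?r)"
      if t: "t \<in> {0<..1}" for t
      unfolding smoothness_modulus_def
    proof (intro SUP_least)
      fix h :: "real^'d" assume "h \<in> {h. norm h \<le> t}"
      then have h: "norm h \<le> t" by simp
      have "Lp_norm p (lebesgue_on (inner_cube (real ?r *\<^sub>R h))) (fwd_diff ?r h ?f)
          \<le> ennreal (C * a * min 1 (real M * norm h) ^ ?r * (real (?r + 1) * y) powr ?P)"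
        unfolding y_def by (rule C(2)[OF p M n S a order_refl sets_inner_cube])
      also have "\<dots> = ennreal (H * min 1 (real M * norm h) ^ ?r)" by (simp add: H_def mult_ac)
      also have "\<dots> \<le> ennreal (H * min 1 (real M * t) ^ ?r)"
        using h M H by (intro ennreal_leI mult_left_mono power_mono min.mono) auto
      finally show "Lp_norm p (lebesgue_on (inner_cube (real ?r *\<^sub>R h))) (fwd_diff ?r h ?f)
          \<le> ennreal (H * min 1 (real M * t) ^ ?r)" .
    qed
    have semi: "besov_seminorm s \<tau> p ?f \<le> ennreal (D * H * real M powr s)"
      using M by (intro D(2) H sm) auto
    have "besov_norm s \<tau> p ?f \<le> ennreal H + ennreal (D * H * real M powr s)"
      unfolding besov_norm_def by (intro add_mono f_le semi)
    also have "\<dots> = ennreal (H + D * H * real M powr s)" using H D by (simp flip: ennreal_plus)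
    also have "\<dots> \<le> ennreal 1"
    proof (rule ennreal_leI)
      have "1 \<le> real M powr s" using M s by (intro ge_one_powr_ge_zero) auto
      then have "H + D * H * real M powr s \<le> H * real M powr s + D * H * real M powr s"
        using H by (simp add: mult_le_cancel_left1)
      also have "\<dots> = A * a * y powr ?P * real M powr s"
      proof -
        have "C * a * (Q * Y) * Z + D * (C * a * (Q * Y)) * Z = (1 + D) * C * Q * a * Y * Z"
          for Q Y Z :: real
          by (simp add: algebra_simps)
        then show ?thesis
          unfolding H_def A_def powr_mult .
      qed
      also have "\<dots> \<le> A * (1 / A * real M powr (-s) * y powr (- ?P)) * y powr ?P * real M powr s"
        using A ale unfolding y_def by (intro mult_right_mono mult_left_mono) auto
      also have "\<dots> = 1" using A y M by (simp add: powr_minus field_simps)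
      finally show "H + D * H * real M powr s \<le> 1" .
    qed
    finally have norm: "besov_norm s \<tau> p ?f \<le> 1" by simp
    have cont: "continuous_on X ?f" for X
      using continuous_on_subset[OF continuous_on_bump_sum subset_UNIV] .
    have "?f \<in> borel_measurable (lebesgue_on unit_cube)"
      by (intro continuous_imp_measurable_on_sets_lebesgue cont) auto
    moreover have "Lp_norm p (lebesgue_on unit_cube) ?f < \<infinity>" "besov_seminorm s \<tau> p ?f < \<infinity>"
      using f_le semi by (auto intro: le_less_trans)
    ultimately show "?f \<in> besov_ball s \<tau> p"
      using norm cont by (simp add: besov_ball_def besov_space_def Lp_space_def)
  qed (use A in simp)
qed

section \<open>Shifted Gaussian noise\<close>

lemma prob_space_gaussian_law:
  assumes "0 \<le> \<sigma>"
  shows "prob_space (gaussian_law \<sigma>)"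
  using assms by (auto simp: gaussian_law_def prob_space_return intro: prob_space_normal_density)

lemma sets_gaussian_law [measurable_cong]: "sets (gaussian_law \<sigma>) = sets borel"
  by (simp add: gaussian_law_def)

lemma space_gaussian_law [simp]: "space (gaussian_law \<sigma>) = UNIV"
  by (simp add: gaussian_law_def)

text \<open>The noise law before completion. The change of measure is carried out here, where
  product measurability is available; integrals agree with those for the completed law.\<close>

abbreviation noise_prod :: "nat \<Rightarrow> real \<Rightarrow> (nat \<Rightarrow> real) measure" where
  "noise_prod m \<sigma> \<equiv> Pi\<^sub>M {..<m} (\<lambda>_. gaussian_law \<sigma>)"

lemma prob_space_noise_prod: "0 \<le> \<sigma> \<Longrightarrow> prob_space (noise_prod m \<sigma>)"
  by (intro prob_space_PiM prob_space_gaussian_law)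

lemma space_noise_law: "space (noise_law m \<sigma>) = {..<m} \<rightarrow>\<^sub>E UNIV"
  by (simp add: noise_law_def space_PiM)

lemma nn_integral_noise_law: "integral\<^sup>N (noise_law m \<sigma>) f = integral\<^sup>N (noise_prod m \<sigma>) f"
  by (simp add: noise_law_def nn_integral_completion)

text \<open>Completing the square in the exponent.\<close>

lemma normal_density_tilt:
  assumes "0 < \<sigma>"
  shows "normal_density 0 \<sigma> t * exp (\<delta> * t / \<sigma>\<^sup>2 - \<delta>\<^sup>2 / (2 * \<sigma>\<^sup>2)) = normal_density 0 \<sigma> (t - \<delta>)"
proof -
  have "- (t - 0)\<^sup>2 / (2 * \<sigma>\<^sup>2) + (\<delta> * t / \<sigma>\<^sup>2 - \<delta>\<^sup>2 / (2 * \<sigma>\<^sup>2)) = - (t - \<delta> - 0)\<^sup>2 / (2 * \<sigma>\<^sup>2)"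
    using assms by (simp add: field_simps power2_eq_square)
  then show ?thesis
    unfolding normal_density_def by (simp only: mult.assoc exp_add[symmetric])
qed

lemma nn_integral_gaussian_shift:
  assumes "0 < \<sigma>" and [measurable]: "F \<in> borel_measurable borel"
  shows "(\<integral>\<^sup>+t. ennreal (exp (\<delta> * t / \<sigma>\<^sup>2 - \<delta>\<^sup>2 / (2 * \<sigma>\<^sup>2))) * F t \<partial>gaussian_law \<sigma>)
    = (\<integral>\<^sup>+t. F (t + \<delta>) \<partial>gaussian_law \<sigma>)"
proof -
  have "(\<integral>\<^sup>+t. ennreal (exp (\<delta> * t / \<sigma>\<^sup>2 - \<delta>\<^sup>2 / (2 * \<sigma>\<^sup>2))) * F t \<partial>gaussian_law \<sigma>)
      = (\<integral>\<^sup>+t. ennreal (normal_density 0 \<sigma> t) * (ennreal (exp (\<delta> * t / \<sigma>\<^sup>2 - \<delta>\<^sup>2 / (2 * \<sigma>\<^sup>2))) * F t) \<partial>lborel)"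
    using assms by (simp add: gaussian_law_def nn_integral_density)
  also have "\<dots> = (\<integral>\<^sup>+t. ennreal (normal_density 0 \<sigma> (t - \<delta>)) * F t \<partial>lborel)"
    using normal_density_tilt[OF assms(1)]
    by (intro nn_integral_cong) (simp add: mult.assoc[symmetric] ennreal_mult[symmetric])
  also have "\<dots> = (\<integral>\<^sup>+t. ennreal (normal_density 0 \<sigma> t) * F (t + \<delta>) \<partial>lborel)"
    by (subst nn_integral_real_affine[where c = 1 and t = \<delta>]) (auto simp: add.commute)
  also have "\<dots> = (\<integral>\<^sup>+t. F (t + \<delta>) \<partial>gaussian_law \<sigma>)"
    using assms by (simp add: gaussian_law_def nn_integral_density)
  finally show ?thesis .
qed

section \<open>Change of measure for shifts of the noise vector\<close>

definition shift :: "nat \<Rightarrow> (nat \<Rightarrow> real) \<Rightarrow> (nat \<Rightarrow> real) \<Rightarrow> (nat \<Rightarrow> real)" where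
  "shift m \<delta> \<eta> = (\<lambda>i\<in>{..<m}. \<eta> i + \<delta> i)"

text \<open>The density of the Gaussian law with mean \<open>\<delta>\<close> relative to the
  centred one, as \<open>distr_shift\<close> confirms.\<close>

definition likelihood :: "nat \<Rightarrow> real \<Rightarrow> (nat \<Rightarrow> real) \<Rightarrow> (nat \<Rightarrow> real) \<Rightarrow> real" where
  "likelihood m \<sigma> \<delta> \<eta> = exp (\<Sum>i<m. \<delta> i * \<eta> i / \<sigma>\<^sup>2 - (\<delta> i)\<^sup>2 / (2 * \<sigma>\<^sup>2))"

lemma measurable_shift [measurable]: "shift m \<delta> \<in> measurable (noise_prod m \<sigma>) (noise_prod m \<sigma>)"
  unfolding shift_def by measurable

lemma measurable_likelihood [measurable]: "likelihood m \<sigma> \<delta> \<in> borel_measurable (noise_prod m \<sigma>')"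
  unfolding likelihood_def by measurable

lemma likelihood_pos: "0 < likelihood m \<sigma> \<delta> \<eta>"
  by (simp add: likelihood_def)

text \<open>The Cameron-Martin formula in finite dimension. Both sides are identified with the
  product of the shifted one-dimensional laws, since they agree with it on boxes and the likelihood
  factorizes.\<close>

lemma distr_shift:
  assumes \<sigma>: "0 < \<sigma>"
  shows "distr (noise_prod m \<sigma>) (noise_prod m \<sigma>) (shift m \<delta>)
    = density (noise_prod m \<sigma>) (\<lambda>\<eta>. ennreal (likelihood m \<sigma> \<delta> \<eta>))"
proof -
  let ?g = "gaussian_law \<sigma>" and ?N = "noise_prod m \<sigma>"
  let ?M = "\<lambda>i. distr ?g borel (\<lambda>t. t + \<delta> i)"
  interpret g: prob_space ?g using \<sigma> by (intro prob_space_gaussian_law) simp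
  interpret G: product_prob_space "\<lambda>_::nat. ?g" by standard
  have pM: "prob_space (?M i)" for i by (rule g.prob_space_distr) measurable
  interpret M: product_prob_space ?M
    by (intro product_prob_spaceI pM)
  have sets: "sets ?N = sets (Pi\<^sub>M {..<m} ?M)"
    by (rule sets_PiM_cong) (auto simp: sets_gaussian_law)
  have emM: "emeasure (?M i) A = emeasure ?g {t. t + \<delta> i \<in> A}" if "A \<in> sets (?M i)" for i A
    using that by (subst emeasure_distr) (auto simp: vimage_def)
  have "distr ?N ?N (shift m \<delta>) = Pi\<^sub>M {..<m} ?M"
  proof (rule M.PiM_eqI)
    fix A assume A: "\<And>i. i \<in> {..<m} \<Longrightarrow> A i \<in> sets (?M i)"
    have PE: "Pi\<^sub>E {..<m} A \<in> sets ?N"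
      using A by (intro sets_PiM_I_finite) (simp_all add: sets_gaussian_law)
    have "emeasure (distr ?N ?N (shift m \<delta>)) (Pi\<^sub>E {..<m} A)
        = emeasure ?N (shift m \<delta> -` (Pi\<^sub>E {..<m} A) \<inter> space ?N)"
      using PE by (rule emeasure_distr[OF measurable_shift])
    also have "shift m \<delta> -` (Pi\<^sub>E {..<m} A) \<inter> space ?N = (\<Pi>\<^sub>E i\<in>{..<m}. {t. t + \<delta> i \<in> A i})"
      by (intro set_eqI) (simp add: shift_def space_PiM restrict_PiE_iff PiE_iff extensional_def conj_commute)
    also have "emeasure ?N \<dots> = (\<Prod>i<m. emeasure ?g {t. t + \<delta> i \<in> A i})"
    proof (rule G.emeasure_PiM)
      fix i assume "i \<in> {..<m}"
      then have [measurable]: "A i \<in> sets borel" using A by simp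
      have "(\<lambda>t. t + \<delta> i) -` A i \<inter> space borel \<in> sets borel" by measurable
      then show "{t. t + \<delta> i \<in> A i} \<in> sets ?g" by (simp add: sets_gaussian_law vimage_def)
    qed simp
    finally show "emeasure (distr ?N ?N (shift m \<delta>)) (Pi\<^sub>E {..<m} A) = (\<Prod>i<m. emeasure (?M i) (A i))"
      using A emM by simp
  qed (simp_all only: sets_distr sets_density sets finite_lessThan)
  moreover have "density ?N (\<lambda>\<eta>. ennreal (likelihood m \<sigma> \<delta> \<eta>)) = Pi\<^sub>M {..<m} ?M"
  proof (rule M.PiM_eqI)
    fix A assume A: "\<And>i. i \<in> {..<m} \<Longrightarrow> A i \<in> sets (?M i)"
    have PE: "Pi\<^sub>E {..<m} A \<in> sets ?N"
      using A by (intro sets_PiM_I_finite) (simp_all add: sets_gaussian_law)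
    let ?R = "\<lambda>i t. ennreal (exp (\<delta> i * t / \<sigma>\<^sup>2 - (\<delta> i)\<^sup>2 / (2 * \<sigma>\<^sup>2))) * indicator (A i) t"
    have "emeasure (density ?N (\<lambda>\<eta>. ennreal (likelihood m \<sigma> \<delta> \<eta>))) (Pi\<^sub>E {..<m} A)
        = (\<integral>\<^sup>+\<eta>. ennreal (likelihood m \<sigma> \<delta> \<eta>) * indicator (Pi\<^sub>E {..<m} A) \<eta> \<partial>?N)"
      by (intro emeasure_density PE) measurable
    also have "\<dots> = (\<integral>\<^sup>+\<eta>. (\<Prod>i<m. ?R i (\<eta> i)) \<partial>?N)"
    proof (rule nn_integral_cong)
      fix \<eta> assume "\<eta> \<in> space ?N"
      then have ext: "\<eta> \<in> extensional {..<m}" by (simp add: space_PiM PiE_iff)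
      have "indicator (Pi\<^sub>E {..<m} A) \<eta> = (\<Prod>i<m. indicator (A i) (\<eta> i) :: ennreal)"
      proof (cases "\<eta> \<in> Pi\<^sub>E {..<m} A")
        case True
        then show ?thesis by (auto simp: PiE_iff)
      next
        case False
        then obtain i where "i < m" "\<eta> i \<notin> A i" using ext by (auto simp: PiE_iff)
        then have "(\<Prod>i<m. indicator (A i) (\<eta> i) :: ennreal) = 0"
          by (intro prod_zero bexI[of _ i]) auto
        with False show ?thesis by simp
      qed
      then show "ennreal (likelihood m \<sigma> \<delta> \<eta>) * indicator (Pi\<^sub>E {..<m} A) \<eta> = (\<Prod>i<m. ?R i (\<eta> i))"
        by (simp add: likelihood_def exp_sum prod_ennreal prod.distrib)
    qed
    also have "\<dots> = (\<Prod>i<m. \<integral>\<^sup>+t. ?R i t \<partial>?g)"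
      using A by (intro G.product_nn_integral_prod) auto
    also have "\<dots> = (\<Prod>i<m. emeasure (?M i) (A i))"
    proof (rule prod.cong[OF refl])
      fix i assume i: "i \<in> {..<m}"
      then have [measurable]: "A i \<in> sets borel" using A by simp
      have "(\<integral>\<^sup>+t. ?R i t \<partial>?g) = (\<integral>\<^sup>+t. indicator (A i) (t + \<delta> i) \<partial>?g)"
        by (rule nn_integral_gaussian_shift[OF \<sigma>]) measurable
      also have "\<dots> = (\<integral>\<^sup>+t. indicator (A i) t \<partial>?M i)" by (subst nn_integral_distr) auto
      finally show "(\<integral>\<^sup>+t. ?R i t \<partial>?g) = emeasure (?M i) (A i)" by simp
    qed
    finally show "emeasure (density ?N (\<lambda>\<eta>. ennreal (likelihood m \<sigma> \<delta> \<eta>))) (Pi\<^sub>E {..<m} A)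
        = (\<Prod>i<m. emeasure (?M i) (A i))" .
  qed (simp_all only: sets_distr sets_density sets finite_lessThan)
  ultimately show ?thesis by simp
qed

lemma nn_integral_shift:
  assumes "0 < \<sigma>" and [measurable]: "F \<in> borel_measurable (noise_prod m \<sigma>)"
  shows "(\<integral>\<^sup>+\<eta>. F (shift m \<delta> \<eta>) \<partial>noise_prod m \<sigma>)
    = (\<integral>\<^sup>+\<eta>. ennreal (likelihood m \<sigma> \<delta> \<eta>) * F \<eta> \<partial>noise_prod m \<sigma>)"
proof -
  have "(\<integral>\<^sup>+\<eta>. F (shift m \<delta> \<eta>) \<partial>noise_prod m \<sigma>)
      = (\<integral>\<^sup>+\<eta>. F \<eta> \<partial>distr (noise_prod m \<sigma>) (noise_prod m \<sigma>) (shift m \<delta>))"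
    by (subst nn_integral_distr) auto
  then show ?thesis unfolding distr_shift[OF assms(1)] by (simp add: nn_integral_density)
qed

lemma nn_integral_likelihood:
  assumes "0 < \<sigma>"
  shows "(\<integral>\<^sup>+\<eta>. ennreal (likelihood m \<sigma> \<delta> \<eta>) \<partial>noise_prod m \<sigma>) = 1"
proof -
  interpret prob_space "noise_prod m \<sigma>" using assms by (intro prob_space_noise_prod) simp
  show ?thesis
    using nn_integral_shift[OF assms, of "\<lambda>_. 1" m \<delta>] by (simp add: emeasure_space_1)
qed

text \<open>The square is a constant times the likelihood for the doubled shift, whose integral is
  1. So the second moment is that constant.\<close>

lemma likelihood_square:
  assumes "0 < \<sigma>"
  shows "(likelihood m \<sigma> \<delta> \<eta>)\<^sup>2
    = exp ((\<Sum>i<m. (\<delta> i)\<^sup>2) / \<sigma>\<^sup>2) * likelihood m \<sigma> (\<lambda>i. 2 * \<delta> i) \<eta>"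
proof -
  have "2 * (\<Sum>i<m. \<delta> i * \<eta> i / \<sigma>\<^sup>2 - (\<delta> i)\<^sup>2 / (2 * \<sigma>\<^sup>2))
      = (\<Sum>i<m. (\<delta> i)\<^sup>2) / \<sigma>\<^sup>2 + (\<Sum>i<m. 2 * \<delta> i * \<eta> i / \<sigma>\<^sup>2 - (2 * \<delta> i)\<^sup>2 / (2 * \<sigma>\<^sup>2))"
    unfolding sum_distrib_left sum_divide_distrib sum.distrib[symmetric]
    by (intro sum.cong refl) (use assms in \<open>simp add: field_simps power2_eq_square\<close>)
  then show ?thesis
    unfolding likelihood_def by (simp only: exp_add[symmetric] exp_double[symmetric])
qed

text \<open>Integrate \<open>L - L\<^sup>2 / 4 \<le> min 1 L\<close>, where the likelihood ratio \<open>L\<close> has mean 1 and second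
  moment \<open>exp x\<close>.\<close>

lemma nn_integral_min_likelihood:
  assumes \<sigma>: "0 < \<sigma>" and x: "x = (\<Sum>i<m. (\<delta> i)\<^sup>2) / \<sigma>\<^sup>2"
  shows "ennreal (1/2 - x/2) \<le> (\<integral>\<^sup>+\<eta>. ennreal (min 1 (likelihood m \<sigma> \<delta> \<eta>)) \<partial>noise_prod m \<sigma>)"
    (is "_ \<le> ?I")
proof (cases "x \<le> 1")
  case True
  have x0: "0 \<le> x" unfolding x by (intro divide_nonneg_nonneg sum_nonneg) auto
  have quad: "L \<le> min 1 L + L\<^sup>2 / 4" for L :: real
  proof -
    have "0 \<le> (L / 2 - 1)\<^sup>2" by simp
    then show ?thesis by (simp add: power2_eq_square field_simps min_def)
  qed
  have "1 = (\<integral>\<^sup>+\<eta>. ennreal (likelihood m \<sigma> \<delta> \<eta>) \<partial>noise_prod m \<sigma>)"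
    by (simp add: nn_integral_likelihood[OF \<sigma>])
  also have "\<dots> \<le> (\<integral>\<^sup>+\<eta>. ennreal (min 1 (likelihood m \<sigma> \<delta> \<eta>))
      + ennreal (exp x / 4) * ennreal (likelihood m \<sigma> (\<lambda>i. 2 * \<delta> i) \<eta>) \<partial>noise_prod m \<sigma>)"
  proof (rule nn_integral_mono)
    fix \<eta>
    have "ennreal (likelihood m \<sigma> \<delta> \<eta>)
      \<le> ennreal (min 1 (likelihood m \<sigma> \<delta> \<eta>) + exp x / 4 * likelihood m \<sigma> (\<lambda>i. 2 * \<delta> i) \<eta>)"
      using quad[of "likelihood m \<sigma> \<delta> \<eta>"] likelihood_square[OF \<sigma>, of m \<delta> \<eta>] x
      by (intro ennreal_leI) simp
    also have "\<dots> = ennreal (min 1 (likelihood m \<sigma> \<delta> \<eta>))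
        + ennreal (exp x / 4) * ennreal (likelihood m \<sigma> (\<lambda>i. 2 * \<delta> i) \<eta>)"
      by (simp add: ennreal_plus less_imp_le[OF likelihood_pos] flip: ennreal_mult)
    finally show "ennreal (likelihood m \<sigma> \<delta> \<eta>) \<le> \<dots>" .
  qed
  also have "\<dots> = ?I + ennreal (exp x / 4)"
    by (subst nn_integral_add) (auto simp: nn_integral_cmult nn_integral_likelihood[OF \<sigma>])
  finally have le: "1 \<le> ?I + ennreal (exp x / 4)" .
  show ?thesis
  proof (cases "?I = \<infinity>")
    case False
    then obtain y where y: "0 \<le> y" "?I = ennreal y" by (cases ?I) auto
    have "ennreal 1 \<le> ennreal (y + exp x / 4)" using le y by (simp add: ennreal_plus)
    then have "1 \<le> y + exp x / 4" using y by (subst (asm) ennreal_le_iff) auto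
    \<comment> \<open>On \<open>[0, 1]\<close> this gives \<open>exp x \<le> 1 + 2 * x\<close>, so
      the integral is at least \<open>3/4 - x/2\<close>, which suffices.\<close>
    moreover have "exp x \<le> 1 + x + x\<^sup>2" using x0 True by (rule exp_bound)
    moreover have "x\<^sup>2 \<le> x" using x0 True by (simp add: power2_eq_square mult_left_le)
    ultimately have "1/2 - x/2 \<le> y" using x0 by linarith
    then show ?thesis unfolding y(2) by (rule ennreal_leI)
  qed simp
\<comment> \<open>For \<open>x > 1\<close> the left side is \<open>ennreal\<close> of a negative
  number, which is 0.\<close>
qed (simp add: ennreal_neg)

text \<open>Le Cam's two-point bound: \<open>u\<close> and \<open>v\<close> are the losses of one
  estimate against two hypotheses, the second evaluated under shifted noise. The bound is linear in
  \<open>x\<close>, and trivial once \<open>x \<ge> 1\<close>, so that it can be averaged over pairs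
  knowing only the mean of \<open>x\<close>.\<close>

lemma gaussian_two_point:
  assumes \<sigma>: "0 < \<sigma>" and x: "x = (\<Sum>i<m. (\<delta> i)\<^sup>2) / \<sigma>\<^sup>2" and D: "0 \<le> D"
    and u: "u \<in> borel_measurable (noise_law m \<sigma>)" and v: "v \<in> borel_measurable (noise_law m \<sigma>)"
    and uv: "\<And>\<eta>. \<eta> \<in> space (noise_law m \<sigma>) \<Longrightarrow> ennreal D \<le> u \<eta> + v \<eta>"
  shows "ennreal (D * (1/2 - x/2))
    \<le> (\<integral>\<^sup>+\<eta>. u \<eta> \<partial>noise_law m \<sigma>) + (\<integral>\<^sup>+\<eta>. v (shift m \<delta> \<eta>) \<partial>noise_law m \<sigma>)"
proof -
  let ?N = "noise_prod m \<sigma>" and ?L = "likelihood m \<sigma> \<delta>"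
  \<comment> \<open>Measurability holds only for the completed law, so \<open>u\<close> and
    \<open>v\<close> are replaced by measurable versions for the product law.\<close>
  obtain u0 where [measurable]: "u0 \<in> borel_measurable ?N" and u0: "AE \<eta> in ?N. u \<eta> = u0 \<eta>"
    using completion_ex_borel_measurable[of u ?N] u unfolding noise_law_def by blast
  obtain v0 where [measurable]: "v0 \<in> borel_measurable ?N" and v0: "AE \<eta> in ?N. v \<eta> = v0 \<eta>"
    using completion_ex_borel_measurable[of v ?N] v unfolding noise_law_def by blast
  \<comment> \<open>The exceptional set of \<open>v\<close> must also be negligible after the shift;
    this holds because the shifted law has a density.\<close>
  have "AE \<eta> in distr ?N ?N (shift m \<delta>). v \<eta> = v0 \<eta>"
    unfolding distr_shift[OF \<sigma>] using v0 by (subst AE_density) auto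
  then have "AE \<eta> in ?N. v (shift m \<delta> \<eta>) = v0 (shift m \<delta> \<eta>)"
    by (rule AE_distrD[rotated]) measurable
  then have "(\<integral>\<^sup>+\<eta>. v (shift m \<delta> \<eta>) \<partial>noise_law m \<sigma>) = (\<integral>\<^sup>+\<eta>. v0 (shift m \<delta> \<eta>) \<partial>?N)"
    unfolding nn_integral_noise_law by (rule nn_integral_cong_AE)
  also have "\<dots> = (\<integral>\<^sup>+\<eta>. ennreal (?L \<eta>) * v0 \<eta> \<partial>?N)" by (rule nn_integral_shift[OF \<sigma>]) measurable
  finally have I: "(\<integral>\<^sup>+\<eta>. u \<eta> \<partial>noise_law m \<sigma>) + (\<integral>\<^sup>+\<eta>. v (shift m \<delta> \<eta>) \<partial>noise_law m \<sigma>)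
      = (\<integral>\<^sup>+\<eta>. u0 \<eta> + ennreal (?L \<eta>) * v0 \<eta> \<partial>?N)"
    unfolding nn_integral_noise_law nn_integral_cong_AE[OF u0]
    by (subst nn_integral_add) auto
  have "ennreal (D * (1/2 - x/2)) = ennreal D * ennreal (1/2 - x/2)"
    using D by (rule ennreal_mult')
  also have "\<dots> \<le> ennreal D * (\<integral>\<^sup>+\<eta>. ennreal (min 1 (?L \<eta>)) \<partial>?N)"
    by (intro mult_left_mono nn_integral_min_likelihood[OF \<sigma> x]) simp
  also have "\<dots> = (\<integral>\<^sup>+\<eta>. ennreal D * ennreal (min 1 (?L \<eta>)) \<partial>?N)"
    by (rule nn_integral_cmult[symmetric]) measurable
  \<comment> \<open>Pointwise, \<open>D * min 1 L \<le> (u + v) * min 1 L \<le> u + L * v\<close>,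
    where \<open>L\<close> is the likelihood.\<close>
  also have "\<dots> \<le> (\<integral>\<^sup>+\<eta>. u0 \<eta> + ennreal (?L \<eta>) * v0 \<eta> \<partial>?N)"
  proof (rule nn_integral_mono_AE)
    have "AE \<eta> in ?N. ennreal D \<le> u \<eta> + v \<eta>"
      using uv by (intro AE_I2) (simp add: space_noise_law space_PiM)
    then show "AE \<eta> in ?N. ennreal D * ennreal (min 1 (?L \<eta>)) \<le> u0 \<eta> + ennreal (?L \<eta>) * v0 \<eta>"
      using u0 v0
    proof eventually_elim
      case (elim \<eta>)
      have "ennreal (min 1 (?L \<eta>)) \<le> 1" by (simp add: ennreal_le_1)
      then have "ennreal (min 1 (?L \<eta>)) * u0 \<eta> \<le> 1 * u0 \<eta>" by (rule mult_right_mono) simp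
      moreover have "ennreal (min 1 (?L \<eta>)) * v0 \<eta> \<le> ennreal (?L \<eta>) * v0 \<eta>"
        by (intro mult_right_mono ennreal_leI) auto
      moreover have "ennreal D * ennreal (min 1 (?L \<eta>)) \<le> (u0 \<eta> + v0 \<eta>) * ennreal (min 1 (?L \<eta>))"
        using elim by (intro mult_right_mono) auto
      moreover have "(u0 \<eta> + v0 \<eta>) * ennreal (min 1 (?L \<eta>))
          = ennreal (min 1 (?L \<eta>)) * u0 \<eta> + ennreal (min 1 (?L \<eta>)) * v0 \<eta>"
        by (simp add: algebra_simps)
      ultimately show ?case by (metis add_mono mult_1 order_trans)
    qed
  qed
  finally show ?thesis unfolding I .
qed

section \<open>Lower bounds for the risk\<close>

lemma space_Lp_borel [simp]: "space (Lp_borel q M) = Lp_space q M"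
  by (auto simp: Lp_borel_def Lp_open_def intro!: space_measure_of)

lemma Lp_open_sets: "Lp_open q M U \<Longrightarrow> U \<in> sets (Lp_borel q M)"
  unfolding Lp_borel_def by (subst sets_measure_of) (auto simp: Lp_open_def)

text \<open>The \<open>L\<^sub>1\<close> distance on a set \<open>W\<close> is \<open>L\<^sub>q\<close>-continuous, hence Borel measurable.\<close>

lemma measurable_L1_dist:
  assumes q: "1 \<le> q" and g: "g \<in> borel_measurable M" and W: "W \<in> sets M"
    and wm: "emeasure M W = ennreal w" and w: "0 < w"
  shows "(\<lambda>f. \<integral>\<^sup>+z\<in>W. ennreal \<bar>g z - f z\<bar> \<partial>M) \<in> borel_measurable (Lp_borel q M)"
proof (rule borel_measurableI_less)
  fix c :: ennreal
  let ?F = "\<lambda>f. \<integral>\<^sup>+z\<in>W. ennreal \<bar>g z - f z\<bar> \<partial>M"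
  define \<kappa> where "\<kappa> = 2 * w powr (1 - enn2real (1 / q))"
  have k: "0 < \<kappa>" using w by (simp add: \<kappa>_def)
  have "Lp_open q M {f \<in> Lp_space q M. ?F f < c}"
    unfolding Lp_open_def
  proof (intro conjI ballI)
    fix f assume "f \<in> {f \<in> Lp_space q M. ?F f < c}"
    then have f: "f \<in> Lp_space q M" and fc: "?F f < c" by auto
    have fm: "f \<in> borel_measurable M" using f by (simp add: Lp_space_def)
    obtain a where a: "0 \<le> a" "?F f = ennreal a" using fc by (cases "?F f") auto
    obtain \<epsilon> where e: "0 < \<epsilon>" "ennreal (a + \<epsilon>) \<le> c"
    proof (cases c)
      case (real b)
      with fc a have "a < b" by (simp add: ennreal_less_iff)
      with real that[of "b - a"] show ?thesis by simp
    next
      case top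
      with that[of 1] show ?thesis by simp
    qed
    show "\<exists>e>0. \<forall>h\<in>Lp_space q M. Lp_norm q M (\<lambda>x. h x - f x) < e \<longrightarrow> h \<in> {f \<in> Lp_space q M. ?F f < c}"
    \<comment> \<open>A change of \<open>f\<close> by less than this radius in the
      \<open>L_q\<close> norm changes the local distance by less than
      \<open>\<epsilon>\<close>.\<close>
    proof (intro exI[of _ "ennreal (\<epsilon> / \<kappa>)"] conjI ballI impI)
      show "0 < ennreal (\<epsilon> / \<kappa>)" using e k by simp
      fix h assume h: "h \<in> Lp_space q M" and le: "Lp_norm q M (\<lambda>x. h x - f x) < ennreal (\<epsilon> / \<kappa>)"
      have hm: "h \<in> borel_measurable M" using h by (simp add: Lp_space_def)
      note [measurable] = g fm hm W
      obtain n where n: "0 \<le> n" "Lp_norm q M (\<lambda>x. h x - f x) = ennreal n"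
        using le by (cases "Lp_norm q M (\<lambda>x. h x - f x)") auto
      have "n < \<epsilon> / \<kappa>" using le n by (simp add: ennreal_less_iff)
      then have nk: "\<kappa> * n < \<epsilon>" using k by (simp add: field_simps)
      have "?F h \<le> (\<integral>\<^sup>+z. ennreal \<bar>g z - f z\<bar> * indicator W z + ennreal \<bar>h z - f z\<bar> * indicator W z \<partial>M)"
      proof (rule nn_integral_mono)
        fix z
        have "ennreal \<bar>g z - h z\<bar> \<le> ennreal (\<bar>g z - f z\<bar> + \<bar>h z - f z\<bar>)" by (rule ennreal_leI) simp
        then show "ennreal \<bar>g z - h z\<bar> * indicator W z
            \<le> ennreal \<bar>g z - f z\<bar> * indicator W z + ennreal \<bar>h z - f z\<bar> * indicator W z"
          by (cases "z \<in> W") (simp_all add: ennreal_plus)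
      qed
      also have "\<dots> = ?F f + (\<integral>\<^sup>+z\<in>W. ennreal \<bar>h z - f z\<bar> \<partial>M)"
        by (intro nn_integral_add) measurable
      also have "\<dots> \<le> ?F f + ennreal \<kappa> * Lp_norm q M (\<lambda>x. h x - f x)"
        unfolding \<kappa>_def by (intro add_left_mono nn_integral_le_Lp_norm q W wm w) measurable
      also have "\<dots> = ennreal (a + \<kappa> * n)" using a n k by (simp add: ennreal_mult)
      also have "\<dots> < ennreal (a + \<epsilon>)" using a nk e by (intro ennreal_lessI) auto
      also have "\<dots> \<le> c" by (rule e)
      finally show "h \<in> {f \<in> Lp_space q M. ?F f < c}" using h by simp
    qed
  qed auto
  from Lp_open_sets[OF this] show "{f \<in> space (Lp_borel q M). ?F f < c} \<in> sets (Lp_borel q M)" by simp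
qed

text \<open>An \<open>L_1\<close> loss for every \<open>q\<close>: it is additive over disjoint
  sets, which lets losses on different cells be added up, and it depends measurably on the
  estimate.\<close>

definition local_loss ::
    "(real^'d) set \<Rightarrow> (real^'d \<Rightarrow> real) \<Rightarrow> (real^'d \<Rightarrow> real) \<Rightarrow> ennreal" where
  "local_loss W f g = (\<integral>\<^sup>+z\<in>W. ennreal \<bar>f z - g z\<bar> \<partial>lebesgue_on unit_cube)"

definition cube_sets :: "real \<Rightarrow> (real^'d) set set" where
  "cube_sets w = {W. W \<in> sets lebesgue \<and> W \<subseteq> unit_cube \<and> 0 < w \<and> emeasure lebesgue W = ennreal w}"

lemma cube_sets_emeasure: "W \<in> cube_sets w \<Longrightarrow> emeasure lebesgue W = ennreal w"
  by (simp only: cube_sets_def mem_Collect_eq)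

lemma cube_setsI:
  "W \<in> sets lebesgue \<Longrightarrow> W \<subseteq> unit_cube \<Longrightarrow> 0 < w \<Longrightarrow> emeasure lebesgue W = ennreal w \<Longrightarrow> W \<in> cube_sets w"
  by (simp only: cube_sets_def mem_Collect_eq simp_thms)

lemma cube_setsD:
  fixes W :: "(real^'d) set"
  assumes "W \<in> cube_sets w"
  shows "W \<in> sets (lebesgue_on unit_cube)" "emeasure (lebesgue_on unit_cube) W = ennreal w" "0 < w"
  using assms by (auto simp: cube_sets_def sets_restrict_space emeasure_restrict_space)

lemma noisy_data_PiE: "noisy_data m x f \<eta> \<in> {..<m} \<rightarrow>\<^sub>E UNIV"
  by (auto simp: noisy_data_def)

lemma algorithm_Lp_space:
  assumes "A \<in> algorithms m K \<sigma> q x"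
  shows "A (noisy_data m x f \<eta>) \<in> Lp_space q (lebesgue_on unit_cube)"
proof -
  have "A \<in> ({..<m} \<rightarrow>\<^sub>E UNIV) \<rightarrow> Lp_space q (lebesgue_on unit_cube)"
    using assms by (simp add: algorithms_def)
  then show ?thesis by (rule Pi_mem) (rule noisy_data_PiE)
qed

text \<open>The data come from \<open>f'\<close> and the loss is taken against \<open>f\<close>: a
  two-point comparison evaluates one estimate against two hypotheses.\<close>

lemma measurable_local_loss:
  fixes f :: "real^'d \<Rightarrow> real"
  assumes q: "1 \<le> q" and A: "A \<in> algorithms m K \<sigma> q x" and f': "f' \<in> K"
    and f: "f \<in> borel_measurable (lebesgue_on unit_cube)" and W: "W \<in> cube_sets w"
  shows "(\<lambda>\<eta>. local_loss W f (A (noisy_data m x f' \<eta>))) \<in> borel_measurable (noise_law m \<sigma>)"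
proof -
  have "(\<lambda>\<eta>. A (noisy_data m x f' \<eta>)) \<in> measurable (noise_law m \<sigma>) (Lp_borel q (lebesgue_on unit_cube))"
    using A f' by (simp add: algorithms_def)
  from measurable_compose[OF this measurable_L1_dist[OF q f cube_setsD[OF W]]]
  show ?thesis unfolding local_loss_def .
qed

text \<open>The factor is the reciprocal of the constant in
  \<open>nn_integral_le_Lp_norm\<close>.\<close>

lemma local_loss_le_risk:
  fixes f :: "real^'d \<Rightarrow> real"
  assumes q: "1 \<le> q" and A: "A \<in> algorithms m K \<sigma> q x" and fK: "f \<in> K"
    and f: "f \<in> borel_measurable (lebesgue_on unit_cube)" and W: "W \<in> cube_sets w"
  shows "ennreal (w powr (enn2real (1 / q) - 1) / 2)
      * (\<integral>\<^sup>+\<eta>. local_loss W f (A (noisy_data m x f \<eta>)) \<partial>noise_law m \<sigma>)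
    \<le> worst_case_risk m K \<sigma> q x A"
proof -
  let ?N = "\<lambda>\<eta>. Lp_norm q (lebesgue_on unit_cube) (\<lambda>z. f z - A (noisy_data m x f \<eta>) z)"
  let ?c = "w powr (enn2real (1 / q) - 1) / 2" and ?k = "2 * w powr (1 - enn2real (1 / q))"
  note W' = cube_setsD[OF W]
  have ck: "?c * ?k = 1" using W'(3) by (simp flip: powr_add)
  have "ennreal ?c * (\<integral>\<^sup>+\<eta>. local_loss W f (A (noisy_data m x f \<eta>)) \<partial>noise_law m \<sigma>)
      = (\<integral>\<^sup>+\<eta>. ennreal ?c * local_loss W f (A (noisy_data m x f \<eta>)) \<partial>noise_law m \<sigma>)"
    by (rule nn_integral_cmult[symmetric]) (rule measurable_local_loss[OF q A fK f W])
  also have "\<dots> \<le> (\<integral>\<^sup>+\<eta>. ?N \<eta> \<partial>noise_law m \<sigma>)"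
  proof (rule nn_integral_mono)
    fix \<eta>
    have "A (noisy_data m x f \<eta>) \<in> borel_measurable (lebesgue_on unit_cube)"
      using algorithm_Lp_space[OF A] by (simp add: Lp_space_def)
    then have "local_loss W f (A (noisy_data m x f \<eta>)) \<le> ennreal ?k * ?N \<eta>"
      unfolding local_loss_def using f by (intro nn_integral_le_Lp_norm q W') measurable
    then have "ennreal ?c * local_loss W f (A (noisy_data m x f \<eta>)) \<le> ennreal ?c * (ennreal ?k * ?N \<eta>)"
      by (rule mult_left_mono) simp
    also have "\<dots> = ennreal (?c * ?k) * ?N \<eta>"
      by (subst ennreal_mult) (auto simp: mult.assoc)
    also have "\<dots> = ?N \<eta>" unfolding ck by simp
    finally show "ennreal ?c * local_loss W f (A (noisy_data m x f \<eta>)) \<le> ?N \<eta>" .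
  qed
  also have "\<dots> \<le> worst_case_risk m K \<sigma> q x A"
    unfolding worst_case_risk_def by (rule SUP_upper[OF fK])
  finally show ?thesis .
qed

lemma local_loss_separation:
  fixes f f' :: "real^'d \<Rightarrow> real"
  assumes f: "f \<in> borel_measurable (lebesgue_on unit_cube)" "f' \<in> borel_measurable (lebesgue_on unit_cube)"
    and g: "g \<in> Lp_space q (lebesgue_on unit_cube)" and W: "W \<in> cube_sets w"
    and a: "0 \<le> a" "\<And>z. z \<in> W \<Longrightarrow> a \<le> \<bar>f z - f' z\<bar>"
  shows "ennreal (a * w) \<le> local_loss W f g + local_loss W f' g"
proof -
  let ?M = "lebesgue_on (unit_cube :: (real^'d) set)"
  note W' = cube_setsD[OF W]
  have gm: "g \<in> borel_measurable ?M" using g by (simp add: Lp_space_def)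
  note [measurable] = f gm W'(1)
  have "ennreal (a * w) = (\<integral>\<^sup>+z. ennreal a * indicator W z \<partial>?M)"
    using a W' by (simp add: nn_integral_cmult_indicator ennreal_mult)
  also have "\<dots> \<le> (\<integral>\<^sup>+z. ennreal \<bar>f z - g z\<bar> * indicator W z + ennreal \<bar>f' z - g z\<bar> * indicator W z \<partial>?M)"
  proof (rule nn_integral_mono)
    fix z
    show "ennreal a * indicator W z
        \<le> ennreal \<bar>f z - g z\<bar> * indicator W z + ennreal \<bar>f' z - g z\<bar> * indicator W z"
    proof (cases "z \<in> W")
      case True
      have "ennreal a \<le> ennreal (\<bar>f z - g z\<bar> + \<bar>f' z - g z\<bar>)"
        using a(2)[OF True] by (intro ennreal_leI) linarith
      with True show ?thesis by (simp add: ennreal_plus)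
    qed simp
  qed
  also have "\<dots> = local_loss W f g + local_loss W f' g"
    unfolding local_loss_def by (intro nn_integral_add) measurable
  finally show ?thesis .
qed

lemma prob_space_noise_law: "0 \<le> \<sigma> \<Longrightarrow> prob_space (noise_law m \<sigma>)"
  unfolding noise_law_def
  using prob_space_noise_prod[of \<sigma> m] by (rule prob_space.prob_space_completion)

text \<open>Equal data give equal estimates, which cannot be close to both functions. Of the factor
  \<open>1/4\<close>, one half comes from the comparison of \<open>L_1\<close> with
  \<open>L_q\<close> and the other from averaging the two risks.\<close>

lemma indistinguishable_risk:
  fixes f f' :: "real^'d \<Rightarrow> real"
  assumes q: "1 \<le> q" and \<sigma>: "0 \<le> \<sigma>" and A: "A \<in> algorithms m K \<sigma> q x"
    and fK: "f \<in> K" "f' \<in> K" and eq: "\<And>i. i < m \<Longrightarrow> f (x i) = f' (x i)"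
    and f: "f \<in> borel_measurable (lebesgue_on unit_cube)" "f' \<in> borel_measurable (lebesgue_on unit_cube)"
    and W: "W \<in> cube_sets w" and a: "0 \<le> a" "\<And>z. z \<in> W \<Longrightarrow> a \<le> \<bar>f z - f' z\<bar>"
  shows "ennreal (a * w powr enn2real (1 / q) / 4) \<le> worst_case_risk m K \<sigma> q x A"
proof -
  let ?R = "worst_case_risk m K \<sigma> q x A" and ?c = "w powr (enn2real (1 / q) - 1) / 2"
  let ?l = "\<lambda>f \<eta>. local_loss W f (A (noisy_data m x f \<eta>))"
  have w: "0 < w" using W by (simp add: cube_sets_def)
  have data: "noisy_data m x f' = noisy_data m x f"
    using eq by (intro ext) (auto simp: noisy_data_def)
  interpret prob_space "noise_law m \<sigma>" by (rule prob_space_noise_law[OF \<sigma>])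
  have m1: "?l f \<in> borel_measurable (noise_law m \<sigma>)" by (rule measurable_local_loss[OF q A fK(1) f(1) W])
  have m2: "?l f' \<in> borel_measurable (noise_law m \<sigma>)" by (rule measurable_local_loss[OF q A fK(2) f(2) W])
  have "ennreal (a * w) = (\<integral>\<^sup>+\<eta>. ennreal (a * w) \<partial>noise_law m \<sigma>)" by (simp add: emeasure_space_1)
  also have "\<dots> \<le> (\<integral>\<^sup>+\<eta>. ?l f \<eta> + ?l f' \<eta> \<partial>noise_law m \<sigma>)"
    unfolding data
    by (intro nn_integral_mono local_loss_separation[OF f algorithm_Lp_space[OF A] W a])
  also have "\<dots> = (\<integral>\<^sup>+\<eta>. ?l f \<eta> \<partial>noise_law m \<sigma>) + (\<integral>\<^sup>+\<eta>. ?l f' \<eta> \<partial>noise_law m \<sigma>)"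
    using m1 m2 by (rule nn_integral_add)
  finally have "ennreal ?c * ennreal (a * w)
      \<le> ennreal ?c * ((\<integral>\<^sup>+\<eta>. ?l f \<eta> \<partial>noise_law m \<sigma>) + (\<integral>\<^sup>+\<eta>. ?l f' \<eta> \<partial>noise_law m \<sigma>))"
    by (rule mult_left_mono) simp
  also have "\<dots> \<le> ?R + ?R"
    unfolding distrib_left
    by (intro add_mono local_loss_le_risk[OF q A fK(1) f(1) W] local_loss_le_risk[OF q A fK(2) f(2) W])
  also have "?R + ?R = ennreal 2 * ?R" by (simp add: mult_2)
  finally have "ennreal (1/2) * (ennreal ?c * ennreal (a * w)) \<le> ennreal (1/2) * (ennreal 2 * ?R)"
    by (rule mult_left_mono) simp
  also have "ennreal (1/2) * (ennreal 2 * ?R) = ?R"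
  proof -
    have half: "ennreal (1/2) * ennreal 2 = 1" by (subst ennreal_mult[symmetric]) simp_all
    show ?thesis unfolding mult.assoc[symmetric] half by simp
  qed
  also have "ennreal (1/2) * (ennreal ?c * ennreal (a * w)) = ennreal (1/2 * (?c * (a * w)))"
    using a(1) w by (simp only: ennreal_mult' divide_nonneg_nonneg zero_le_one zero_le_numeral powr_ge_zero)
  also have "1/2 * (?c * (a * w)) = a * w powr enn2real (1 / q) / 4"
    using w by (simp add: powr_diff)
  finally show ?thesis .
qed

lemma sum_Pow_split:
  fixes G :: "'b set \<Rightarrow> ennreal"
  assumes "finite J" "j \<in> J"
  shows "(\<Sum>S\<in>Pow J. G S) = (\<Sum>S\<in>Pow (J - {j}). G S + G (insert j S))"
proof -
  have "Pow J = Pow (J - {j}) \<union> insert j ` Pow (J - {j})"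
    using Pow_insert[of j "J - {j}"] assms by (simp add: insert_absorb)
  moreover have "inj_on (insert j) (Pow (J - {j}))"
    by (intro inj_onI) (auto simp: insert_eq_iff)
  moreover have "Pow (J - {j}) \<inter> insert j ` Pow (J - {j}) = {}" by auto
  ultimately show ?thesis
    using assms by (simp add: sum.union_disjoint sum.reindex sum.distrib)
qed

text \<open>Assouad's argument: for each \<open>j\<close>, pair the hypotheses \<open>S\<close> and \<open>insert j S\<close>, and average the
  resulting two-point bounds over all \<open>S\<close>.\<close>

lemma assouad_risk:
  fixes F :: "'b set \<Rightarrow> real^'d \<Rightarrow> real"
  assumes q: "1 \<le> q" and \<sigma>: "0 < \<sigma>" and A: "A \<in> algorithms m K \<sigma> q x"
    and J: "finite J" "J \<noteq> {}" and FK: "\<And>S. S \<subseteq> J \<Longrightarrow> F S \<in> K"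
    and F: "\<And>S. S \<subseteq> J \<Longrightarrow> F S \<in> borel_measurable (lebesgue_on unit_cube)"
    and W: "\<And>j. j \<in> J \<Longrightarrow> W j \<in> cube_sets w" and disj: "disjoint_family_on W J"
    and w: "0 < w" "real (card J) * w \<le> 1" and a: "0 \<le> a"
    and sep: "\<And>j S z. j \<in> J \<Longrightarrow> S \<subseteq> J - {j} \<Longrightarrow> z \<in> W j \<Longrightarrow> a \<le> \<bar>F S z - F (insert j S) z\<bar>"
    and data: "\<And>j S i. j \<in> J \<Longrightarrow> S \<subseteq> J - {j} \<Longrightarrow> i < m \<Longrightarrow> F (insert j S) (x i) = F S (x i) + \<delta> j i"
    and small: "(\<Sum>j\<in>J. \<Sum>i<m. (\<delta> j i)\<^sup>2) \<le> \<sigma>\<^sup>2 * real (card J) / 2"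
  shows "ennreal (a * w * real (card J) / 16) \<le> worst_case_risk m K \<sigma> q x A"
proof -
  let ?R = "worst_case_risk m K \<sigma> q x A" and ?n = "real (card J)" and ?N = "noise_law m \<sigma>"
  let ?l = "\<lambda>j S \<eta>. local_loss (W j) (F S) (A (noisy_data m x (F S) \<eta>))"
  let ?X = "\<lambda>j. (\<Sum>i<m. (\<delta> j i)\<^sup>2) / \<sigma>\<^sup>2"
  have n: "1 \<le> ?n" using J by (simp add: Suc_le_eq card_gt_0_iff)
  have pair: "ennreal (a * w * (1/2 - ?X j / 2))
      \<le> (\<integral>\<^sup>+\<eta>. ?l j S \<eta> \<partial>?N) + (\<integral>\<^sup>+\<eta>. ?l j (insert j S) \<eta> \<partial>?N)"
    if j: "j \<in> J" and S: "S \<subseteq> J - {j}" for j S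
  proof -
    have SJ: "S \<subseteq> J" "insert j S \<subseteq> J" using j S by auto
    \<comment> \<open>Since \<open>\<delta> j\<close> does not depend on \<open>S\<close>, adding
      the cell \<open>j\<close> amounts to a fixed shift of the noise, whatever the other cells
      are.\<close>
    have shift: "noisy_data m x (F (insert j S)) \<eta> = noisy_data m x (F S) (shift m (\<delta> j) \<eta>)" for \<eta>
      using data[OF j S] by (auto simp: noisy_data_def shift_def)
    show ?thesis
      unfolding shift
    proof (rule gaussian_two_point[OF \<sigma> refl])
      show "0 \<le> a * w" using a w by simp
      show "?l j S \<in> borel_measurable ?N"
        by (rule measurable_local_loss[OF q A FK[OF SJ(1)] F[OF SJ(1)] W[OF j]])
      show "(\<lambda>\<eta>. local_loss (W j) (F (insert j S)) (A (noisy_data m x (F S) \<eta>))) \<in> borel_measurable ?N"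
        by (rule measurable_local_loss[OF q A FK[OF SJ(1)] F[OF SJ(2)] W[OF j]])
      show "ennreal (a * w) \<le> ?l j S \<eta> + local_loss (W j) (F (insert j S)) (A (noisy_data m x (F S) \<eta>))" for \<eta>
        by (rule local_loss_separation[OF F[OF SJ(1)] F[OF SJ(2)] algorithm_Lp_space[OF A] W[OF j] a])
          (rule sep[OF j S])
    qed
  qed
  have risk: "ennreal (1/2) * (\<Sum>j\<in>J. \<integral>\<^sup>+\<eta>. ?l j S \<eta> \<partial>?N) \<le> ?R" if S: "S \<subseteq> J" for S
  proof -
    let ?U = "\<Union>j\<in>J. W j"
    have "emeasure lebesgue ?U = (\<Sum>j\<in>J. emeasure lebesgue (W j))"
      using J W disj by (intro sum_emeasure[symmetric]) (auto simp: cube_sets_def)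
    also have "\<dots> = (\<Sum>j\<in>J. ennreal w)" by (intro sum.cong refl cube_sets_emeasure W)
    also have "\<dots> = ennreal (\<Sum>j\<in>J. w)" using w by (intro sum_ennreal) simp
    also have "(\<Sum>j\<in>J. w) = ?n * w" by simp
    finally have "emeasure lebesgue ?U = ennreal (?n * w)" .
    moreover have "?U \<in> sets lebesgue" using J W by (intro sets.finite_UN) (auto simp: cube_sets_def)
    moreover have "?U \<subseteq> unit_cube" using W by (auto simp: cube_sets_def)
    moreover have nw: "0 < ?n * w" using n w by simp
    ultimately have U: "?U \<in> cube_sets (?n * w)" by (simp add: cube_sets_def)
    have "local_loss ?U (F S) g = (\<Sum>j\<in>J. local_loss (W j) (F S) g)"
      if "g \<in> Lp_space q (lebesgue_on unit_cube)" for g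
    proof -
      have [measurable]: "g \<in> borel_measurable (lebesgue_on unit_cube)" using that by (simp add: Lp_space_def)
      note [measurable] = F[OF S]
      have m: "(\<lambda>z. ennreal \<bar>F S z - g z\<bar> * indicator (W j) z) \<in> borel_measurable (lebesgue_on unit_cube)"
        if "j \<in> J" for j
      proof -
        note [measurable] = cube_setsD(1)[OF W[OF that]]
        show ?thesis by measurable
      qed
      have "local_loss ?U (F S) g
          = (\<integral>\<^sup>+z. (\<Sum>j\<in>J. ennreal \<bar>F S z - g z\<bar> * indicator (W j) z) \<partial>lebesgue_on unit_cube)"
        unfolding local_loss_def indicator_UN_disjoint[OF J(1) disj] sum_distrib_left ..
      also have "\<dots> = (\<Sum>j\<in>J. local_loss (W j) (F S) g)"
        unfolding local_loss_def by (intro nn_integral_sum m)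
      finally show ?thesis .
    qed
    then have "(\<integral>\<^sup>+\<eta>. local_loss ?U (F S) (A (noisy_data m x (F S) \<eta>)) \<partial>?N)
        = (\<integral>\<^sup>+\<eta>. (\<Sum>j\<in>J. ?l j S \<eta>) \<partial>?N)"
      using algorithm_Lp_space[OF A] by simp
    also have "\<dots> = (\<Sum>j\<in>J. \<integral>\<^sup>+\<eta>. ?l j S \<eta> \<partial>?N)"
      by (intro nn_integral_sum measurable_local_loss[OF q A FK[OF S] F[OF S] W])
    finally have sum: "(\<Sum>j\<in>J. \<integral>\<^sup>+\<eta>. ?l j S \<eta> \<partial>?N)
      = (\<integral>\<^sup>+\<eta>. local_loss ?U (F S) (A (noisy_data m x (F S) \<eta>)) \<partial>?N)" by simp
    \<comment> \<open>The union of the sets \<open>W j\<close> has measure at most 1 and the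
      exponent is not positive, so the factor relating the \<open>L_1\<close> loss to the risk is at
      least \<open>1/2\<close>.\<close>
    have "enn2real (1 / q) \<le> 1"
    proof (cases "q = \<infinity>")
      case False
      then show ?thesis using one_le_enn2real[OF q] by (simp add: enn2real_inverse_exponent)
    qed simp
    then have "1 \<le> (?n * w) powr (enn2real (1 / q) - 1)"
      using powr_mono2'[of "enn2real (1 / q) - 1" "?n * w" 1] nw w by simp
    then have "ennreal (1/2) \<le> ennreal ((?n * w) powr (enn2real (1 / q) - 1) / 2)"
      by (intro ennreal_leI) simp
    then have "ennreal (1/2) * (\<Sum>j\<in>J. \<integral>\<^sup>+\<eta>. ?l j S \<eta> \<partial>?N)
        \<le> ennreal ((?n * w) powr (enn2real (1 / q) - 1) / 2) * (\<Sum>j\<in>J. \<integral>\<^sup>+\<eta>. ?l j S \<eta> \<partial>?N)"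
      by (rule mult_right_mono) simp
    also have "\<dots> \<le> ?R" unfolding sum by (rule local_loss_le_risk[OF q A FK[OF S] F[OF S] U])
    finally show ?thesis .
  qed
  \<comment> \<open>The number of sets \<open>S\<close> avoiding a given \<open>j\<close>, that is,
    of pairs for that \<open>j\<close>; there are twice as many hypotheses.\<close>
  let ?P = "2 ^ (card J - 1) :: real"
  have PP: "2 ^ card J = 2 * ?P" using n by (cases "card J") auto
  have X: "(\<Sum>j\<in>J. ?X j) \<le> ?n / 2"
    using small \<sigma> by (simp add: sum_divide_distrib[symmetric] field_simps)
  have "a * w * ?n / 4 \<le> a * w * (?n / 2 - (\<Sum>j\<in>J. ?X j) / 2)"
    using mult_left_mono[of "?n / 4" "?n / 2 - (\<Sum>j\<in>J. ?X j) / 2" "a * w"] X a w by simp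
  also have "\<dots> = (\<Sum>j\<in>J. a * w * (1/2 - ?X j / 2))"
    by (simp add: sum_distrib_left[symmetric] sum_subtractf sum_divide_distrib[symmetric])
  \<comment> \<open>Crowded cells can give negative summands, which \<open>ennreal\<close> cuts off
    to 0. Passing to positive parts only enlarges the sum and makes it commute with
    \<open>ennreal\<close>.\<close>
  also have "\<dots> \<le> (\<Sum>j\<in>J. max 0 (a * w * (1/2 - ?X j / 2)))" by (intro sum_mono) simp
  finally have "ennreal (a * w * ?n / 4) \<le> ennreal (\<Sum>j\<in>J. max 0 (a * w * (1/2 - ?X j / 2)))"
    by (rule ennreal_leI)
  also have "\<dots> = (\<Sum>j\<in>J. ennreal (max 0 (a * w * (1/2 - ?X j / 2))))"
    by (intro sum_ennreal[symmetric]) simp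
  also have "\<dots> = (\<Sum>j\<in>J. ennreal (a * w * (1/2 - ?X j / 2)))"
    by (intro sum.cong refl) (simp add: max_def ennreal_neg)
  finally have sumX: "ennreal (a * w * ?n / 4) \<le> (\<Sum>j\<in>J. ennreal (a * w * (1/2 - ?X j / 2)))" .
  have "ennreal ?P * ennreal (a * w * ?n / 4) \<le> ennreal ?P * (\<Sum>j\<in>J. ennreal (a * w * (1/2 - ?X j / 2)))"
    by (rule mult_left_mono[OF sumX]) simp
  also have "\<dots> = (\<Sum>j\<in>J. \<Sum>S\<in>Pow (J - {j}). ennreal (a * w * (1/2 - ?X j / 2)))"
    using J by (simp add: sum_distrib_left card_Pow ennreal_power[symmetric])
  also have "\<dots> \<le> (\<Sum>j\<in>J. \<Sum>S\<in>Pow (J - {j}).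
      (\<integral>\<^sup>+\<eta>. ?l j S \<eta> \<partial>?N) + (\<integral>\<^sup>+\<eta>. ?l j (insert j S) \<eta> \<partial>?N))"
    by (intro sum_mono pair) auto
  also have "\<dots> = (\<Sum>j\<in>J. \<Sum>S\<in>Pow J. \<integral>\<^sup>+\<eta>. ?l j S \<eta> \<partial>?N)"
    using J(1) by (intro sum.cong refl sum_Pow_split[symmetric])
  also have "\<dots> = (\<Sum>S\<in>Pow J. \<Sum>j\<in>J. \<integral>\<^sup>+\<eta>. ?l j S \<eta> \<partial>?N)" by (rule sum.swap)
  finally have "ennreal (1/2) * (ennreal ?P * ennreal (a * w * ?n / 4))
      \<le> ennreal (1/2) * (\<Sum>S\<in>Pow J. \<Sum>j\<in>J. \<integral>\<^sup>+\<eta>. ?l j S \<eta> \<partial>?N)"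
    by (rule mult_left_mono) simp
  also have "\<dots> \<le> (\<Sum>S\<in>Pow J. ?R)"
    unfolding sum_distrib_left[of "ennreal (1/2)" _ "Pow J"] by (intro sum_mono risk) auto
  also have "\<dots> = ennreal (2 * ?P) * ?R"
    using J(1) unfolding PP[symmetric] by (simp add: card_Pow flip: ennreal_power)
  finally have "ennreal (1 / (2 * ?P)) * (ennreal (1/2) * (ennreal ?P * ennreal (a * w * ?n / 4)))
      \<le> ennreal (1 / (2 * ?P)) * (ennreal (2 * ?P) * ?R)"
    by (rule mult_left_mono) simp
  also have "\<dots> = ennreal (1 / (2 * ?P) * (2 * ?P)) * ?R"
    by (subst ennreal_mult) (auto simp: mult.assoc)
  also have "\<dots> = ?R" by simp
  also have "ennreal (1 / (2 * ?P)) * (ennreal (1/2) * (ennreal ?P * ennreal (a * w * ?n / 4)))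
      = ennreal (1 / (2 * ?P) * (1/2 * (?P * (a * w * ?n / 4))))"
    using a w by (simp only: ennreal_mult[symmetric] divide_nonneg_nonneg mult_nonneg_nonneg
        zero_le_power zero_le_one zero_le_numeral of_nat_0_le_iff less_imp_le)
  \<comment> \<open>The constant 16 collects \<open>1/4\<close> from averaging over
    \<open>j\<close>, \<open>1/2\<close> from the comparison with the risk, and \<open>1/2\<close>
    from the ratio of pairs to hypotheses.\<close>
  also have "1 / (2 * ?P) * (1/2 * (?P * (a * w * ?n / 4))) = a * w * ?n / 16" by (simp add: field_simps)
  finally show ?thesis .
qed

section \<open>The two rates\<close>

lemma borel_measurable_bump_sum:
  "(bump_sum r M a S :: real^'d \<Rightarrow> real) \<in> borel_measurable (lebesgue_on unit_cube)"
  by (intro continuous_imp_measurable_on_sets_lebesgue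
      continuous_on_subset[OF continuous_on_bump_sum]) auto

lemma core_cube_sets:
  fixes j :: "'d::finite \<Rightarrow> nat"
  assumes "1 \<le> M" "j \<in> cells M"
  shows "(core M j :: (real^'d) set) \<in> cube_sets ((1 / (2 * real M)) ^ CARD('d))"
  by (rule cube_setsI[OF _ core_subset[OF assms] _ emeasure_core[OF assms(1)]])
    (use assms(1) in \<open>simp_all add: core_def\<close>)

text \<open>A point meets the support of at most one bump. Hence each data site is charged only once
  in the total squared shift over all cells.\<close>

lemma sum_cell_bump_square_le:
  fixes x :: "real^'d"
  assumes "finite S" "\<And>z :: real^'d. bump r z \<le> B"
  shows "(\<Sum>j\<in>S. (cell_bump r M j x)\<^sup>2) \<le> B\<^sup>2"
proof -
  let ?T = "{j \<in> S. cell_bump r M j x \<noteq> 0}"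
  have "(\<Sum>j\<in>S. (cell_bump r M j x)\<^sup>2) = (\<Sum>j\<in>?T. (cell_bump r M j x)\<^sup>2)"
    using assms(1) by (intro sum.mono_neutral_right) auto
  also have "\<dots> \<le> (\<Sum>j\<in>?T. B\<^sup>2)"
    using assms(2) by (intro sum_mono power_mono cell_bump_nonneg) (simp add: cell_bump_def)
  also have "\<dots> = real (card ?T) * B\<^sup>2" by simp
  also have "\<dots> \<le> 1 * B\<^sup>2"
    using card_cell_bump_le_1[of S r M x] by (intro mult_right_mono) simp_all
  finally show ?thesis by simp
qed

lemma exists_resolution:
  fixes y :: real
  assumes "1 \<le> y"
  shows "\<exists>M\<ge>1. y \<le> real M \<and> real M \<le> 2 * y"
  using assms by (intro exI[of _ "nat \<lceil>y\<rceil>"]) (auto; linarith)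

text \<open>Each site activates at most one bump, so \<open>m\<close> sites spoil at most
  \<open>m\<close> cells.\<close>

lemma card_empty_cells:
  fixes x :: "nat \<Rightarrow> real^'d"
  shows "M ^ CARD('d) \<le> card {j \<in> cells M. \<forall>i<m. cell_bump r M j (x i) = 0} + m"
proof -
  let ?E = "{j \<in> cells M. \<forall>i<m. cell_bump r M j (x i) = 0}"
  let ?H = "\<Union>i\<in>{..<m}. {j \<in> cells M. cell_bump r M j (x i) \<noteq> 0}"
  have "M ^ CARD('d) = card (?E \<union> ?H)"
    by (subst card_cells[symmetric]) (auto intro!: arg_cong[where f = card])
  also have "\<dots> \<le> card ?E + card ?H" by (rule card_Un_le)
  also have "card ?H \<le> (\<Sum>i<m. card {j \<in> cells M. cell_bump r M j (x i) \<noteq> 0})"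
    by (intro card_UN_le) simp
  also have "\<dots> \<le> (\<Sum>i<m. 1)" by (intro sum_mono card_cell_bump_le_1)
  finally show ?thesis by simp
qed

text \<open>With \<open>y = n / M ^ d\<close>, bumps of height
  \<open>M powr (-s) * y powr (-1/p)\<close> on a set of measure proportional to \<open>y\<close>
  have the stated \<open>L_q\<close> size. The number \<open>n\<close> of bumps is left free, since
  the sign of the exponent decides which choice is best.\<close>

lemma sampling_lower_bound:
  fixes s :: real and p q \<tau> :: ennreal
  assumes s: "0 < s" and \<tau>: "0 < \<tau>" and p: "0 < p" and q: "1 \<le> q"
  shows "\<exists>C>0. \<forall>M n m \<sigma> (x :: nat \<Rightarrow> real^'d) A.
    1 \<le> M \<longrightarrow> 1 \<le> n \<longrightarrow> 0 \<le> \<sigma> \<longrightarrow> n + m \<le> M ^ CARD('d) \<longrightarrow>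
    A \<in> algorithms m (besov_ball s \<tau> p) \<sigma> q x \<longrightarrow>
    ennreal (C * real M powr (-s) * (real n / real M ^ CARD('d)) powr (enn2real (1 / q) - enn2real (1 / p)))
      \<le> worst_case_risk m (besov_ball s \<tau> p) \<sigma> q x A"
proof -
  let ?r = "besov_order s" and ?P = "enn2real (1 / p)" and ?Q = "enn2real (1 / q)"
  let ?K = "besov_ball s \<tau> p :: (real^'d \<Rightarrow> real) set"
  obtain c where c: "c > 0" "\<And>M n a (S :: ('d \<Rightarrow> nat) set).
    1 \<le> M \<Longrightarrow> 1 \<le> n \<Longrightarrow> finite S \<Longrightarrow> card S \<le> n \<Longrightarrow> 0 \<le> a \<Longrightarrow>
    a \<le> c * real M powr (-s) * (real n / real M ^ CARD('d)) powr (- ?P) \<Longrightarrow>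
    bump_sum ?r M a S \<in> ?K"
    using bump_sum_in_besov_ball[OF s \<tau> p, where 'd = 'd] by metis
  show ?thesis
  \<comment> \<open>The factor \<open>1/4\<close> comes from \<open>indistinguishable_risk\<close>,
    and \<open>(1 / 2) ^ CARD('d)\<close> is the proportion of a cell filled by its core.\<close>
  proof (intro exI[of _ "c / 4 * ((1 / 2) ^ CARD('d)) powr ?Q"] conjI allI impI)
    fix M n m :: nat and \<sigma> :: real and x :: "nat \<Rightarrow> real^'d" and A
    assume M: "1 \<le> M" and n: "1 \<le> n" and \<sigma>: "0 \<le> \<sigma>" and nm: "n + m \<le> M ^ CARD('d)"
      and A: "A \<in> algorithms m ?K \<sigma> q x"
    define y where "y = real n / real M ^ CARD('d)"
    have y: "0 < y" using n M by (simp add: y_def)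
    define a where "a = c * real M powr (-s) * y powr (- ?P)"
    have a: "0 \<le> a" using c by (simp add: a_def)
    let ?E = "{j \<in> cells M. \<forall>i<m. cell_bump ?r M j (x i) = 0}"
    have "n \<le> card ?E" using card_empty_cells[of M m ?r x] nm by linarith
    then obtain J where J: "J \<subseteq> ?E" "card J = n" "finite J" by (rule obtain_subset_with_card_n)
    let ?f = "bump_sum ?r M a J" and ?z = "bump_sum ?r M a {}"
    let ?W = "\<Union>j\<in>J. core M j :: (real^'d) set"
    have fK: "?f \<in> ?K" "?z \<in> ?K"
      by (rule c(2)[OF M n _ _ a]; use J in \<open>simp add: a_def y_def\<close>)+
    have core: "core M j \<in> cube_sets ((1 / (2 * real M)) ^ CARD('d))" if "j \<in> J" for j
      using core_cube_sets[OF M, of j] J that by auto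
    have "emeasure lebesgue ?W = (\<Sum>j\<in>J. emeasure lebesgue (core M j :: (real^'d) set))"
      using J core by (intro sum_emeasure[symmetric] disjoint_family_core M) (auto simp: cube_sets_def)
    also have "\<dots> = (\<Sum>j\<in>J. ennreal ((1 / (2 * real M)) ^ CARD('d)))"
      by (intro sum.cong refl cube_sets_emeasure core)
    also have "\<dots> = ennreal (\<Sum>j\<in>J. (1 / (2 * real M)) ^ CARD('d))" by (intro sum_ennreal) simp
    also have "(\<Sum>j\<in>J. (1 / (2 * real M)) ^ CARD('d)) = (1 / 2) ^ CARD('d) * y"
      using J M by (simp add: y_def power_divide power_mult_distrib)
    finally have W: "?W \<in> cube_sets ((1 / 2) ^ CARD('d) * y)"
      using J core y by (intro cube_setsI sets.finite_UN) (auto simp: cube_sets_def)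
    have "ennreal (a * ((1 / 2) ^ CARD('d) * y) powr ?Q / 4) \<le> worst_case_risk m ?K \<sigma> q x A"
    proof (rule indistinguishable_risk[OF q \<sigma> A fK _ borel_measurable_bump_sum borel_measurable_bump_sum W a])
      show "?f (x i) = ?z (x i)" if "i < m" for i
      proof -
        have "(\<Sum>j\<in>J. cell_bump ?r M j (x i)) = 0" using J that by (intro sum.neutral) auto
        then show ?thesis by (simp add: bump_sum_def)
      qed
      show "a \<le> \<bar>?f z - ?z z\<bar>" if z: "z \<in> ?W" for z
      proof -
        obtain j where j: "j \<in> J" "z \<in> core M j" using z by auto
        have "1 \<le> cell_bump ?r M j z" using cell_bump_ge_1[OF M j(2)] .
        also have "\<dots> \<le> (\<Sum>j\<in>J. cell_bump ?r M j z)"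
          using J j by (intro member_le_sum cell_bump_nonneg) auto
        finally have "a * 1 \<le> a * (\<Sum>j\<in>J. cell_bump ?r M j z)" using a by (rule mult_left_mono)
        then show ?thesis by (simp add: bump_sum_def)
      qed
    qed
    also have "a * ((1 / 2) ^ CARD('d) * y) powr ?Q / 4
        = c / 4 * ((1 / 2) ^ CARD('d)) powr ?Q * real M powr (-s) * (y powr (- ?P) * y powr ?Q)"
      unfolding a_def powr_mult by simp
    also have "y powr (- ?P) * y powr ?Q = y powr (?Q - ?P)" by (simp flip: powr_add)
    finally show "ennreal (c / 4 * ((1 / 2) ^ CARD('d)) powr ?Q * real M powr (-s)
        * (real n / real M ^ CARD('d)) powr (?Q - ?P)) \<le> worst_case_risk m ?K \<sigma> q x A"
      unfolding y_def .
  qed (use c in simp)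
qed

lemma sampling_rate:
  fixes s :: real and p q \<tau> :: ennreal
  assumes s: "0 < s" and \<tau>: "0 < \<tau>" and p: "0 < p" and q: "1 \<le> q"
    and sp: "real CARD('d) * enn2real (1 / p) < s"
  shows "\<exists>C>0. \<forall>m \<sigma> (x :: nat \<Rightarrow> real^'d) A.
    1 \<le> m \<longrightarrow> 0 \<le> \<sigma> \<longrightarrow> A \<in> algorithms m (besov_ball s \<tau> p) \<sigma> q x \<longrightarrow>
    ennreal (C * real m powr (- s / real CARD('d) + max (enn2real (1 / p) - enn2real (1 / q)) 0))
      \<le> worst_case_risk m (besov_ball s \<tau> p) \<sigma> q x A"
proof -
  let ?P = "enn2real (1 / p)" and ?Q = "enn2real (1 / q)" and ?d = "real CARD('d)"
  let ?K = "besov_ball s \<tau> p :: (real^'d \<Rightarrow> real) set"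
  obtain C where C: "C > 0" "\<And>M n m \<sigma> (x :: nat \<Rightarrow> real^'d) A.
    1 \<le> M \<Longrightarrow> 1 \<le> n \<Longrightarrow> 0 \<le> \<sigma> \<Longrightarrow> n + m \<le> M ^ CARD('d) \<Longrightarrow> A \<in> algorithms m ?K \<sigma> q x \<Longrightarrow>
    ennreal (C * real M powr (-s) * (real n / real M ^ CARD('d)) powr (?Q - ?P))
      \<le> worst_case_risk m ?K \<sigma> q x A"
    using sampling_lower_bound[OF s \<tau> p q, where 'd = 'd] by metis
  \<comment> \<open>The exponent of \<open>M\<close> in the bound; dividing by the dimension gives
    the exponent of \<open>m\<close>.\<close>
  define e where "e = - s + ?d * max (?P - ?Q) 0"
  have d: "0 < ?d" by simp
  \<comment> \<open>This is where \<open>s > d/p\<close> enters: a negative exponent turns the upper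
    bound on \<open>M\<close> into a lower bound for the rate.\<close>
  have e: "e < 0"
  proof (cases "?P \<le> ?Q")
    case False
    have "0 \<le> ?d * ?Q" by simp
    moreover have "e = - s + (?d * ?P - ?d * ?Q)"
      using False by (simp add: e_def right_diff_distrib)
    ultimately show ?thesis using sp by linarith
  qed (use s in \<open>simp add: e_def max_def\<close>)
  \<comment> \<open>For \<open>1/p \<le> 1/q\<close> at least half of the cells are used, and this
    costs the power of \<open>1/2\<close>; otherwise the power is 1.\<close>
  define C' where "C' = C * (1 / 2) powr max (?Q - ?P) 0"
  have C': "0 < C'" using C by (simp add: C'_def)
  show ?thesis
  proof (intro exI[of _ "C' * 4 powr e"] conjI allI impI)
    fix m :: nat and \<sigma> :: real and x :: "nat \<Rightarrow> real^'d" and A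
    assume m: "1 \<le> m" and \<sigma>: "0 \<le> \<sigma>" and A: "A \<in> algorithms m ?K \<sigma> q x"
    \<comment> \<open>With at least \<open>2 * m\<close> cells, at least half are free of sites.
      Rounding up loses at most a factor 2, so \<open>M\<close> stays below
      \<open>4 * m powr (1 / ?d)\<close>.\<close>
    let ?y = "(2 * real m) powr (1 / ?d)"
    have y: "1 \<le> ?y" using m d by (intro ge_one_powr_ge_zero) auto
    obtain M where M: "1 \<le> M" "?y \<le> real M" "real M \<le> 2 * ?y" using exists_resolution[OF y] by auto
    have "2 * real m = ?y ^ CARD('d)"
      using m d by (simp add: powr_powr flip: powr_realpow)
    also have "\<dots> \<le> real M ^ CARD('d)" using M y by (intro power_mono) auto
    finally have "real (2 * m) \<le> real (M ^ CARD('d))" by simp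
    then have N: "2 * m \<le> M ^ CARD('d)" by (simp only: of_nat_le_iff)
    have rM: "0 < real M" using M by simp
    define n where "n = (if ?P \<le> ?Q then M ^ CARD('d) - m else 1)"
    have le: "C' * real M powr e \<le> C * real M powr (-s) * (real n / real M ^ CARD('d)) powr (?Q - ?P)"
    proof (cases "?P \<le> ?Q")
      case True
      then have "real n = real M ^ CARD('d) - real m" using N by (simp add: n_def of_nat_diff)
      moreover have "2 * real m \<le> real M ^ CARD('d)" using N by (metis of_nat_le_iff of_nat_mult of_nat_numeral of_nat_power)
      ultimately have "1 / 2 \<le> real n / real M ^ CARD('d)" using rM by (simp add: field_simps)
      then have "(1 / 2) powr (?Q - ?P) \<le> (real n / real M ^ CARD('d)) powr (?Q - ?P)"
        using True by (intro powr_mono2) auto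
      then have "C * real M powr (-s) * (1 / 2) powr (?Q - ?P)
          \<le> C * real M powr (-s) * (real n / real M ^ CARD('d)) powr (?Q - ?P)"
        using C by (intro mult_left_mono) auto
      moreover have "C' = C * (1 / 2) powr (?Q - ?P)" "e = - s"
        using True by (auto simp: C'_def e_def max_def)
      ultimately show ?thesis by (simp only: mult.assoc mult.commute[of "(1 / 2) powr (?Q - ?P)"])
    next
      case False
      have "(real n / real M ^ CARD('d)) powr (?Q - ?P) = (real M powr (- ?d)) powr (?Q - ?P)"
        using False rM by (simp add: n_def powr_minus_divide powr_realpow)
      also have "\<dots> = real M powr (?d * (?P - ?Q))" by (simp add: powr_powr algebra_simps)
      finally have "C * real M powr (-s) * (real n / real M ^ CARD('d)) powr (?Q - ?P)
          = C * (real M powr (-s) * real M powr (?d * (?P - ?Q)))" by simp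
      also have "\<dots> = C' * real M powr e"
        using False by (simp add: C'_def e_def max_def flip: powr_add)
      finally show ?thesis by simp
    qed
    have n1: "1 \<le> n" "n + m \<le> M ^ CARD('d)" using N m by (auto simp: n_def)
    have "(4 * real m powr (1 / ?d)) powr e \<le> real M powr e"
    proof (rule powr_mono2')
      have "?y = 2 powr (1 / ?d) * real m powr (1 / ?d)" by (simp add: powr_mult)
      also have "\<dots> \<le> 2 powr 1 * real m powr (1 / ?d)"
        by (intro mult_right_mono powr_mono) auto
      finally show "real M \<le> 4 * real m powr (1 / ?d)" using M(3) by simp
    qed (use e rM in auto)
    moreover have "(4 * real m powr (1 / ?d)) powr e = 4 powr e * real m powr (e / ?d)"
      by (simp add: powr_mult powr_powr)
    moreover have "e / ?d = - s / ?d + max (?P - ?Q) 0" by (simp add: e_def add_divide_distrib diff_divide_distrib)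
    ultimately have "C' * 4 powr e * real m powr (- s / ?d + max (?P - ?Q) 0) \<le> C' * real M powr e"
      using C' by simp
    with le have "ennreal (C' * 4 powr e * real m powr (- s / ?d + max (?P - ?Q) 0))
        \<le> ennreal (C * real M powr (-s) * (real n / real M ^ CARD('d)) powr (?Q - ?P))"
      by (intro ennreal_leI) linarith
    also have "\<dots> \<le> worst_case_risk m ?K \<sigma> q x A" by (rule C(2)[OF M(1) n1(1) \<sigma> n1(2) A])
    finally show "ennreal (C' * 4 powr e * real m powr (- s / ?d + max (?P - ?Q) 0))
        \<le> worst_case_risk m ?K \<sigma> q x A" .
  qed (use C' in simp)
qed

lemma noise_rate:
  fixes s :: real and p q \<tau> :: ennreal
  assumes s: "0 < s" and \<tau>: "0 < \<tau>" and p: "0 < p" and q: "1 \<le> q"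
  shows "\<exists>C>0. \<forall>m \<sigma> (x :: nat \<Rightarrow> real^'d) A.
    1 \<le> m \<longrightarrow> 0 \<le> \<sigma> \<longrightarrow> A \<in> algorithms m (besov_ball s \<tau> p) \<sigma> q x \<longrightarrow>
    ennreal (C * min 1 ((\<sigma>\<^sup>2 / real m) powr (s / (2 * s + real CARD('d)))))
      \<le> worst_case_risk m (besov_ball s \<tau> p) \<sigma> q x A"
proof -
  let ?r = "besov_order s" and ?P = "enn2real (1 / p)" and ?d = "real CARD('d)"
  let ?K = "besov_ball s \<tau> p :: (real^'d \<Rightarrow> real) set"
  obtain c where c: "c > 0" "\<And>M n a (S :: ('d \<Rightarrow> nat) set).
    1 \<le> M \<Longrightarrow> 1 \<le> n \<Longrightarrow> finite S \<Longrightarrow> card S \<le> n \<Longrightarrow> 0 \<le> a \<Longrightarrow>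
    a \<le> c * real M powr (-s) * (real n / real M ^ CARD('d)) powr (- ?P) \<Longrightarrow>
    bump_sum ?r M a S \<in> ?K"
    using bump_sum_in_besov_ball[OF s \<tau> p, where 'd = 'd] by metis
  obtain B where B: "0 < B" "\<And>x :: real^'d. bump ?r x \<le> B" using bump_bound by metis
  \<comment> \<open>The bound \<open>c\<close> keeps the sums in the Besov ball;
    \<open>1 / (2 * B)\<close> keeps the total squared shift small enough for Assouad's
    argument.\<close>
  define c' where "c' = min c (1 / (2 * B))"
  have c': "0 < c'" "c' \<le> c" using c B by (auto simp: c'_def)
  have "c' * B \<le> 1 / (2 * B) * B" using B by (intro mult_right_mono) (auto simp: c'_def)
  then have "(c' * B)\<^sup>2 \<le> (1 / 2)\<^sup>2" using c' B by (intro power_mono) auto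
  then have cB: "(c' * B)\<^sup>2 \<le> 1 / 2" by (simp add: power2_eq_square)
  define C where "C = c' * (1 / 2) ^ CARD('d) / 16 * 2 powr (-s)"
  have C: "0 < C" using c' by (simp add: C_def)
  have main: "ennreal (C * min 1 ((\<sigma>\<^sup>2 / real m) powr (s / (2 * s + ?d)))) \<le> worst_case_risk m ?K \<sigma> q x A"
    if m: "1 \<le> m" and \<sigma>: "0 < \<sigma>" and A: "A \<in> algorithms m ?K \<sigma> q x"
    for m \<sigma> and x :: "nat \<Rightarrow> real^'d" and A
  proof -
    define v where "v = \<sigma>\<^sup>2 / real m"
    have v: "0 < v" using m \<sigma> by (simp add: v_def)
    \<comment> \<open>The solution of
      \<open>y powr (2 * s + ?d) = real m / \<sigma>\<^sup>2\<close>, for which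
      \<open>y powr (-s)\<close> is exactly the noise rate. If it is below 1, \<open>M\<close> is at
      most 2, and this yields the branch 1 of the minimum.\<close>
    define y where "y = v powr (- 1 / (2 * s + ?d))"
    have y0: "0 < y" using v by (simp add: y_def)
    obtain M where M: "1 \<le> M" "max 1 y \<le> real M" "real M \<le> 2 * max 1 y"
      using exists_resolution[of "max 1 y"] by auto
    have rM: "0 < real M" using M by simp
    define a where "a = c' * real M powr (-s)"
    have a: "0 < a" using c' rM by (simp add: a_def)
    define w where "w = (1 / (2 * real M)) ^ CARD('d)"
    have w: "0 < w" using rM by (simp add: w_def)
    let ?J = "cells M :: ('d \<Rightarrow> nat) set"
    have cardJ: "real (card ?J) = real M ^ CARD('d)" by (simp add: card_cells)
    have Jw: "real (card ?J) * w = (1 / 2) ^ CARD('d)"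
      unfolding cardJ w_def using rM by (simp add: power_mult_distrib[symmetric])
    have "a * w * real (card ?J) / 16 = c' * (1 / 2) ^ CARD('d) / 16 * real M powr (-s)"
      using Jw by (simp add: a_def mult_ac)
    moreover have "2 powr (-s) * min 1 (v powr (s / (2 * s + ?d))) \<le> real M powr (-s)"
    proof -
      have "v powr (s / (2 * s + ?d)) = y powr (-s)" by (simp add: y_def powr_powr)
      then have "min 1 (v powr (s / (2 * s + ?d))) \<le> max 1 y powr (-s)"
        using s y0 by (auto simp: max_def min_def)
      then have "2 powr (-s) * min 1 (v powr (s / (2 * s + ?d))) \<le> (2 * max 1 y) powr (-s)"
        by (simp add: powr_mult)
      also have "\<dots> \<le> real M powr (-s)" using M s rM by (intro powr_mono2') auto
      finally show ?thesis .
    qed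
    ultimately have le: "C * min 1 (v powr (s / (2 * s + ?d))) \<le> a * w * real (card ?J) / 16"
      using c' unfolding C_def by (simp add: mult.assoc mult_left_mono)
    have "ennreal (a * w * real (card ?J) / 16) \<le> worst_case_risk m ?K \<sigma> q x A"
    proof (rule assouad_risk[OF q \<sigma> A, where F = "bump_sum ?r M a" and W = "core M"
          and \<delta> = "\<lambda>j i. a * cell_bump ?r M j (x i)"])
      show "finite ?J" by simp
      show "?J \<noteq> {}" using cardJ rM by (metis card.empty of_nat_0 power_not_zero less_irrefl)
      show "bump_sum ?r M a S \<in> ?K" if "S \<subseteq> ?J" for S
      proof (rule c(2)[OF M(1)])
        show "card S \<le> M ^ CARD('d)" using card_mono[OF finite_cells that] by (simp add: card_cells)
        show "finite S" using that by (rule finite_subset) simp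
        \<comment> \<open>Taking \<open>n\<close> to be the number of all cells makes the density 1,
          so the power involving \<open>?P\<close> disappears.\<close>
        show "a \<le> c * real M powr (-s) * (real (M ^ CARD('d)) / real M ^ CARD('d)) powr (- ?P)"
          using rM c' by (simp add: a_def)
      qed (use a M in auto)
      show "core M j \<in> cube_sets w" if "j \<in> ?J" for j
        unfolding w_def by (rule core_cube_sets[OF M(1) that])
      show "disjoint_family_on (core M :: _ \<Rightarrow> (real^'d) set) ?J"
        by (rule disjoint_family_core[OF M(1)])
      show "real (card ?J) * w \<le> 1" unfolding Jw by (intro power_le_one) auto
      show "a \<le> \<bar>bump_sum ?r M a S z - bump_sum ?r M a (insert j S) z\<bar>"
        if "j \<in> ?J" "S \<subseteq> ?J - {j}" "z \<in> core M j" for j S and z :: "real^'d"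
      proof -
        have "finite S" "j \<notin> S" using that finite_subset[of S ?J] by auto
        then have "\<bar>bump_sum ?r M a S z - bump_sum ?r M a (insert j S) z\<bar> = a * cell_bump ?r M j z"
          using a cell_bump_nonneg[of ?r M j z] by (simp add: bump_sum_def algebra_simps abs_mult)
        moreover have "a * 1 \<le> a * cell_bump ?r M j z"
          using a cell_bump_ge_1[OF M(1) that(3)] by (intro mult_left_mono) auto
        ultimately show ?thesis by simp
      qed
      show "bump_sum ?r M a (insert j S) (x i) = bump_sum ?r M a S (x i) + a * cell_bump ?r M j (x i)"
        if "j \<in> ?J" "S \<subseteq> ?J - {j}" "i < m" for j S i
      proof -
        have "finite S" "j \<notin> S" using that finite_subset[of S ?J] by auto
        then show ?thesis by (simp add: bump_sum_def algebra_simps)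
      qed
      \<comment> \<open>Summing over cells first gives at most \<open>B\<^sup>2\<close> per site,
        however the sites are placed.\<close>
      have "(\<Sum>j\<in>?J. \<Sum>i<m. (a * cell_bump ?r M j (x i))\<^sup>2)
          = (\<Sum>i<m. a\<^sup>2 * (\<Sum>j\<in>?J. (cell_bump ?r M j (x i))\<^sup>2))"
        by (subst sum.swap) (simp add: power_mult_distrib sum_distrib_left)
      also have "\<dots> \<le> (\<Sum>i<m. a\<^sup>2 * B\<^sup>2)"
        by (intro sum_mono mult_left_mono sum_cell_bump_square_le B finite_cells) simp
      also have "\<dots> = real m * ((c' * B)\<^sup>2 * (real M powr (-s))\<^sup>2)"
        by (simp add: a_def power_mult_distrib)
      also have "\<dots> \<le> real m * (1 / 2 * (real M powr (-s))\<^sup>2)"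
        by (intro mult_left_mono mult_right_mono cB) auto
      also have "\<dots> \<le> \<sigma>\<^sup>2 * real (card ?J) / 2"
      proof -
        have sd: "0 < 2 * s + ?d" using s by (simp add: add_pos_pos)
        have "y powr (2 * s + ?d) = v powr (- 1 / (2 * s + ?d) * (2 * s + ?d))"
          unfolding y_def by (rule powr_powr)
        also have "- 1 / (2 * s + ?d) * (2 * s + ?d) = - 1" using sd by simp
        also have "v powr (- 1) = 1 / v" using v by (simp add: powr_minus_divide)
        finally have "1 / v = y powr (2 * s + ?d)" ..
        also have "\<dots> \<le> real M powr (2 * s + ?d)" using M y0 sd by (intro powr_mono2) auto
        also have "\<dots> = real M powr s * real M powr s * real M powr ?d"
          by (simp only: powr_add[symmetric]) simp
        also have "\<dots> = (real M powr s)\<^sup>2 * real M ^ CARD('d)"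
          by (simp add: power2_eq_square powr_realpow[OF rM])
        finally have "1 / v \<le> (real M powr s)\<^sup>2 * real M ^ CARD('d)" .
        then have "real m \<le> \<sigma>\<^sup>2 * ((real M powr s)\<^sup>2 * real M ^ CARD('d))"
          using \<sigma> m by (simp add: v_def field_simps)
        then have "real m * (real M powr (-s))\<^sup>2
            \<le> \<sigma>\<^sup>2 * ((real M powr s)\<^sup>2 * real M ^ CARD('d)) * (real M powr (-s))\<^sup>2"
          by (rule mult_right_mono) simp
        also have "\<dots> = \<sigma>\<^sup>2 * real M ^ CARD('d) * (real M powr s * real M powr (-s))\<^sup>2"
          by (simp add: power_mult_distrib)
        also have "real M powr s * real M powr (-s) = 1" using rM by (simp flip: powr_add)
        finally show ?thesis unfolding cardJ by simp
      qed
      finally show "(\<Sum>j\<in>?J. \<Sum>i<m. (a * cell_bump ?r M j (x i))\<^sup>2) \<le> \<sigma>\<^sup>2 * real (card ?J) / 2" .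
    qed (use a w borel_measurable_bump_sum in auto)
    with ennreal_leI[OF le] show ?thesis unfolding v_def by (rule order_trans)
  qed
  show ?thesis
  proof (intro exI[of _ C] conjI allI impI)
    fix m :: nat and \<sigma> :: real and x :: "nat \<Rightarrow> real^'d" and A
    assume "1 \<le> m" "0 \<le> \<sigma>" "A \<in> algorithms m ?K \<sigma> q x"
    \<comment> \<open>For \<open>\<sigma> = 0\<close> the left side vanishes, because 0 to any power
      is 0 for \<open>powr\<close>.\<close>
    then show "ennreal (C * min 1 ((\<sigma>\<^sup>2 / real m) powr (s / (2 * s + ?d)))) \<le> worst_case_risk m ?K \<sigma> q x A"
      using main[of m \<sigma> A x] by (cases "\<sigma> = 0") auto
  qed (use C in simp)
qed

theorem theorem2:
  fixes s :: real and p q \<tau> :: ennreal and K :: "(real^'d \<Rightarrow> real) set"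
  assumes "0 < p" and "0 < \<tau>" and "1 \<le> q" and "0 < s"
    and "of_nat CARD('d) / p < ennreal s"
    and "q < p + 2 * ennreal s * p / of_nat CARD('d)"
    and "K = besov_ball s \<tau> p"
  shows "\<exists>C::real. C > 0 \<and> (\<forall>m::nat. \<forall>\<sigma>::real. 1 \<le> m \<longrightarrow> 0 \<le> \<sigma> \<longrightarrow>
    ennreal (C * (real m powr (- s / real CARD('d) + max (enn2real (1 / p) - enn2real (1 / q)) 0)
                  + min 1 ((\<sigma>\<^sup>2 / real m) powr (s / (2 * s + real CARD('d))))))
      \<le> minimax_risk m K \<sigma> q)"
proof -
  have sp: "real CARD('d) * enn2real (1 / p) < s"
  proof (cases "p = \<infinity>")
    case False
    then obtain p' where p': "0 < p'" "p = ennreal p'" using \<open>0 < p\<close> by (cases p) auto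
    have "ennreal (real CARD('d) / p') < ennreal s"
      using assms(5) p' by (simp add: divide_ennreal ennreal_of_nat_eq_real_of_nat)
    then show ?thesis
      using p' \<open>p \<noteq> \<infinity>\<close> by (simp add: ennreal_less_iff enn2real_inverse_exponent)
  qed (use \<open>0 < s\<close> in simp)
  obtain C1 where C1: "C1 > 0" "\<And>m \<sigma> (x :: nat \<Rightarrow> real^'d) A.
      1 \<le> m \<Longrightarrow> 0 \<le> \<sigma> \<Longrightarrow> A \<in> algorithms m K \<sigma> q x \<Longrightarrow>
      ennreal (C1 * real m powr (- s / real CARD('d) + max (enn2real (1 / p) - enn2real (1 / q)) 0))
        \<le> worst_case_risk m K \<sigma> q x A"
    using sampling_rate[OF assms(4,2,1,3) sp] unfolding assms(7) by metis
  obtain C2 where C2: "C2 > 0" "\<And>m \<sigma> (x :: nat \<Rightarrow> real^'d) A.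
      1 \<le> m \<Longrightarrow> 0 \<le> \<sigma> \<Longrightarrow> A \<in> algorithms m K \<sigma> q x \<Longrightarrow>
      ennreal (C2 * min 1 ((\<sigma>\<^sup>2 / real m) powr (s / (2 * s + real CARD('d)))))
        \<le> worst_case_risk m K \<sigma> q x A"
    using noise_rate[OF assms(4,2,1,3), where 'd = 'd] unfolding assms(7) by metis
  show ?thesis
  \<comment> \<open>Both bounds hold for the same sites and the same algorithm, so their maximum
    does, and half the sum is at most the maximum.\<close>
  proof (intro exI[of _ "min C1 C2 / 2"] conjI allI impI)
    fix m :: nat and \<sigma> :: real
    assume m: "1 \<le> m" and \<sigma>: "0 \<le> \<sigma>"
    define X where "X = real m powr (- s / real CARD('d) + max (enn2real (1 / p) - enn2real (1 / q)) 0)"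
    define Y where "Y = min 1 ((\<sigma>\<^sup>2 / real m) powr (s / (2 * s + real CARD('d))))"
    have "0 \<le> X" "0 \<le> Y" by (simp_all add: X_def Y_def)
    then have le: "min C1 C2 * X \<le> C1 * X" "min C1 C2 * Y \<le> C2 * Y"
      by (simp_all add: mult_right_mono)
    have "min C1 C2 / 2 * (X + Y) = (min C1 C2 * X + min C1 C2 * Y) / 2"
      by (simp add: algebra_simps)
    also have "\<dots> \<le> (max (C1 * X) (C2 * Y) + max (C1 * X) (C2 * Y)) / 2"
      using le by (intro divide_right_mono add_mono) (auto intro: max.coboundedI1 max.coboundedI2)
    finally have "min C1 C2 / 2 * (X + Y) \<le> max (C1 * X) (C2 * Y)" by simp
    then have "ennreal (min C1 C2 / 2 * (X + Y)) \<le> ennreal (max (C1 * X) (C2 * Y))"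
      by (rule ennreal_leI)
    moreover have "ennreal (max (C1 * X) (C2 * Y)) \<le> worst_case_risk m K \<sigma> q x A"
      if "A \<in> algorithms m K \<sigma> q x" for x and A
      using C1(2)[OF m \<sigma> that] C2(2)[OF m \<sigma> that] by (simp add: max_def X_def Y_def)
    ultimately have "ennreal (min C1 C2 / 2 * (X + Y)) \<le> minimax_risk m K \<sigma> q"
      unfolding minimax_risk_def by (intro INF_greatest) (rule order_trans)
    then show "ennreal (min C1 C2 / 2 * (real m powr (- s / real CARD('d) + max (enn2real (1 / p) - enn2real (1 / q)) 0)
        + min 1 ((\<sigma>\<^sup>2 / real m) powr (s / (2 * s + real CARD('d)))))) \<le> minimax_risk m K \<sigma> q"
      unfolding X_def Y_def .
  qed (use C1 C2 in simp)
qed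

end
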